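(* Let $G$ be a connected wheel-free (finite simple) graph. Then $\Delta L(G)$ is homotopy equivalent to a wedge of circles.
   Context: For $n \ge 3$, the wheel graph $W_n$ is the cone over the cycle $C_n$, i.e. $C_n$ together with an extra vertex adjacent to all vertices of $C_n$. A graph is wheel-free if it contains no subgraph (not necessarily induced) isomorphic to $W_n$ for any $n \ge 3$. The clique complex $\Delta(H)$ of a graph $H$ is the simplicial complex whose simplices are the vertex subsets inducing complete subgraphs. The line graph $L(G)$ has vertex set $E(G)$, two edges being adjacent iff they share exactly one endpoint; $\Delta L(G) = \Delta(L(G))$. A wedge of zero circles is a point.
   Formalization: The formal theorem assumes in addition that G has at least one edge; this excludes only the one-vertex graph, whose line graph is empty, so that ΔL(G) is empty and not homotopy equivalent to any wedge of circles. *)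

theory Defs
  imports "HOL-Analysis.Analysis" "HOL-Library.Ramsey"
begin

text \<open>A graph is a pair of a vertex set and a set of edges, the edges being two-element
  sets of vertices.\<close>

type_synonym 'a ugraph = "'a set \<times> 'a set set"

abbreviation verts :: "'a ugraph \<Rightarrow> 'a set" where "verts G \<equiv> fst G"
abbreviation edges :: "'a ugraph \<Rightarrow> 'a set set" where "edges G \<equiv> snd G"

definition simple_graph :: "'a ugraph \<Rightarrow> bool" where
  "simple_graph G \<longleftrightarrow> edges G \<subseteq> nsets (verts G) 2"

definition connected_graph :: "'a ugraph \<Rightarrow> bool" where
  "connected_graph G \<longleftrightarrow> verts G \<noteq> {} \<and>
     (\<forall>u\<in>verts G. \<forall>v\<in>verts G. (u, v) \<in> {(x, y). {x, y} \<in> edges G}\<^sup>*)"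

definition subgraph :: "'a ugraph \<Rightarrow> 'a ugraph \<Rightarrow> bool" where
  "subgraph H G \<longleftrightarrow> simple_graph H \<and> verts H \<subseteq> verts G \<and> edges H \<subseteq> edges G"

definition isomorphic_graphs :: "'a ugraph \<Rightarrow> 'b ugraph \<Rightarrow> bool" where
  "isomorphic_graphs G H \<longleftrightarrow>
     (\<exists>f. bij_betw f (verts G) (verts H) \<and> edges H = (\<lambda>e. f ` e) ` edges G)"

text \<open>The cycle is a simple graph without repeated edges only for \<open>n \<ge> 3\<close>.\<close>

definition cycle_graph :: "nat \<Rightarrow> nat ugraph" where
  "cycle_graph n = ({..<n}, {{i, Suc i mod n} | i. i < n})"

text \<open>The apex of the cone is \<open>None\<close>.\<close>

definition cone_graph :: "'a ugraph \<Rightarrow> 'a option ugraph" where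
  "cone_graph G = (insert None (Some ` verts G),
     (\<lambda>e. Some ` e) ` edges G \<union> {{None, Some v} | v. v \<in> verts G})"

definition wheel_graph :: "nat \<Rightarrow> nat option ugraph" where
  "wheel_graph n = cone_graph (cycle_graph n)"

definition wheel_free :: "'a ugraph \<Rightarrow> bool" where
  "wheel_free G \<longleftrightarrow> (\<forall>n\<ge>3. \<not> (\<exists>H. subgraph H G \<and> isomorphic_graphs H (wheel_graph n)))"

definition line_graph :: "'a ugraph \<Rightarrow> 'a set ugraph" where
  "line_graph G = (edges G, {{e, f} | e f. e \<in> edges G \<and> f \<in> edges G \<and> card (e \<inter> f) = 1})"

text \<open>The empty set counts as a simplex; it contributes no point to the realization.\<close>

definition clique_complex :: "'a ugraph \<Rightarrow> 'a set set" where
  "clique_complex G = {S. finite S \<and> S \<subseteq> verts G \<and> (\<forall>u\<in>S. \<forall>v\<in>S. u \<noteq> v \<longrightarrow> {u, v} \<in> edges G)}"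

text \<open>Points of the realization are given by barycentric coordinates. As a subspace of the
  function space with its product topology, this is the geometric realization of a finite
  complex; for infinite complexes the topology would in general be coarser than the weak one.\<close>

definition geometric_realization :: "'a set set \<Rightarrow> ('a \<Rightarrow> real) set" where
  "geometric_realization K =
     {x. (\<forall>v. 0 \<le> x v) \<and> {v. x v \<noteq> 0} \<in> K \<and> (\<Sum>v | x v \<noteq> 0. x v) = 1}"

text \<open>The wedge of \<open>k\<close> unit circles with base point \<open>1\<close>, realized inside the product of the
  circles as the points with at most one coordinate different from \<open>1\<close> (coordinates beyond
  \<open>k\<close> are padded by \<open>1\<close>). For \<open>k = 0\<close> this is a single point. The lemmas below show that it is
  the disjoint union of the circles with the base points identified.\<close>

definition wedge_of_circles :: "nat \<Rightarrow> (nat \<Rightarrow> complex) set" where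
  "wedge_of_circles k =
     {z. (\<forall>i<k. z i \<in> sphere 0 1) \<and> (\<forall>i\<ge>k. z i = 1) \<and>
         (\<forall>i j. z i \<noteq> 1 \<and> z j \<noteq> 1 \<longrightarrow> i = j)}"

lemma wedge_of_circles_0: "wedge_of_circles 0 = {\<lambda>_. 1}"
  by (auto simp: wedge_of_circles_def)

lemma wedge_of_circles_quotient_map:
  assumes "0 < k"
  shows "quotient_map (sum_topology (\<lambda>_. top_of_set (sphere 0 1)) {..<k})
           (top_of_set (wedge_of_circles k)) (\<lambda>(i, w) j. if j = i then w else 1)"
    (is "quotient_map ?X ?Y ?q")
proof (rule T1_Spaces.continuous_imp_quotient_map)
  have "compactin ?X (\<Union>i\<in>{..<k}. Pair i ` sphere 0 1)"
  proof (rule compactin_Union[OF finite_imageI])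
    fix S assume "S \<in> (\<lambda>i. Pair i ` sphere (0::complex) 1) ` {..<k}"
    then obtain i where "i < k" "S = Pair i ` sphere 0 1" by auto
    then show "compactin ?X S"
      using image_compactin[OF _ continuous_map_component_injection,
          of "\<lambda>_. top_of_set (sphere (0::complex) 1)" i "sphere 0 1" "{..<k}"]
      by (simp add: compactin_subtopology)
  qed auto
  moreover have "(\<Union>i\<in>{..<k}. Pair i ` sphere (0::complex) 1) = topspace ?X"
    by auto
  ultimately show "compact_space ?X"
    by (simp add: compact_space_def)
  show "Hausdorff_space ?Y"
    by (simp add: Hausdorff_space_subtopology)
  have maps: "?q p \<in> wedge_of_circles k" if "p \<in> topspace ?X" for p
    using that by (auto simp: wedge_of_circles_def split: if_splits)
  have cont: "openin (top_of_set (sphere 0 1)) {w \<in> sphere 0 1. ?q (i, w) \<in> U}"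
    if "open U" for i U
  proof -
    have "continuous_on (sphere 0 1) (\<lambda>w::complex. ?q (i, w))"
    proof (rule continuous_on_coordinatewise_then_product)
      show "continuous_on (sphere 0 1) (\<lambda>w. ?q (i, w) j)" for j
        by (cases "j = i") auto
    qed
    from continuous_openin_preimage_gen[OF this that] show ?thesis
      by (simp add: vimage_def Int_def)
  qed
  have "continuous_map ?X euclidean ?q"
    unfolding continuous_map_def
  proof (intro conjI allI impI)
    fix U :: "(nat \<Rightarrow> complex) set" assume "openin euclidean U"
    then have "open U" by simp
    show "openin ?X {x \<in> topspace ?X. ?q x \<in> U}"
      unfolding openin_sum_topology
    proof (intro conjI ballI)
      fix i assume "i \<in> {..<k}"
      then have "{w. (i, w) \<in> {x \<in> topspace ?X. ?q x \<in> U}} = {w \<in> sphere 0 1. ?q (i, w) \<in> U}"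
        by auto
      then show "openin (top_of_set (sphere 0 1)) {w. (i, w) \<in> {x \<in> topspace ?X. ?q x \<in> U}}"
        using cont[OF \<open>open U\<close>, of i] by (simp only:)
    qed auto
  qed auto
  then show "continuous_map ?X ?Y ?q"
    using maps by (auto simp: continuous_map_in_subtopology)
  show "?q ` topspace ?X = topspace ?Y"
  proof
    show "?q ` topspace ?X \<subseteq> topspace ?Y"
      using maps by auto
    show "topspace ?Y \<subseteq> ?q ` topspace ?X"
    proof
      fix z assume "z \<in> topspace ?Y"
      then have z: "\<forall>i<k. z i \<in> sphere 0 1" "\<forall>i\<ge>k. z i = 1"
          "\<forall>i j. z i \<noteq> 1 \<and> z j \<noteq> 1 \<longrightarrow> i = j"
        by (auto simp: wedge_of_circles_def)
      obtain i where i: "i < k" "\<forall>j. j \<noteq> i \<longrightarrow> z j = 1"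
      proof (cases "\<exists>i. z i \<noteq> 1")
        case True
        then obtain i where "z i \<noteq> 1" by blast
        moreover from this have "i < k"
          using z(2) not_le by blast
        ultimately show ?thesis
          using that[of i] z(3) by blast
      next
        case False
        then show ?thesis
          using that[of 0] assms by blast
      qed
      have "z = ?q (i, z i)"
        using i(2) by (simp add: fun_eq_iff)
      moreover have "(i, z i) \<in> topspace ?X"
        using i(1) z(1) by simp
      ultimately show "z \<in> ?q ` topspace ?X"
        by (rule image_eqI)
    qed
  qed
qed

lemma wedge_of_circles_identification:
  "(\<lambda>j. if j = i then v else 1) = (\<lambda>j. if j = i' then w else 1) \<longleftrightarrow>
     (i, v) = (i', w) \<or> v = 1 \<and> w = 1"
  for i i' :: nat and v w :: complex
  by (auto simp: fun_eq_iff split: if_splits)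

end

theory Submission
  imports Defs
begin

text \<open>If a face \<open>\<tau>\<close> of a complex has an apex \<open>w\<close>, meaning that every simplex containing \<open>\<tau>\<close> stays a
  simplex when \<open>w\<close> is added, then all simplices containing \<open>\<tau>\<close> can be removed without changing the
  homotopy type. In a wheel-free graph neighbourhoods of vertices are forests, so a graph with a
  triangle has an edge \<open>ab\<close> lying in exactly one triangle \<open>abc\<close>; collapsing towards \<open>ac\<close> and \<open>bc\<close>
  removes \<open>ab\<close> from the line complex, and the graph stays connected. Once there are no triangles,
  the line complex is a union of the full simplices on the stars of the vertices. Coning off each
  star by a new vertex and collapsing the other way turns it into the barycentric subdivision of the
  graph. A connected graph is a wedge of circles because a spanning tree can be contracted.\<close>

section \<open>Collapsing simplicial complexes\<close>

text \<open>A cycle in the neighbourhood of \<open>a\<close>, together with \<open>a\<close>, is a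
  wheel; hence the forests. If \<open>b\<close> is a leaf of such a forest with neighbour
  \<open>c\<close>, the link of the vertex \<open>{a, b}\<close> in the line complex is
  contractible: it consists of the simplex of the other edges at \<open>a\<close>, the simplex of
  the other edges at \<open>b\<close>, and one segment from \<open>{a, c}\<close> to
  \<open>{b, c}\<close>. An edge in two triangles would leave two such segments and hence a loop in
  the link. A triangle-free line complex need not be one-dimensional, since all edges at a vertex
  span one simplex; the subdivided graph has extra corners, so the cone points are added before
  anything is removed. Contracting the spanning tree is the only step that is not a removal of
  faces: the contraction drags the ends of the remaining edges along, so it has to be extended over
  these edges before it can pass to the quotient.\<close>

definition abstract_complex :: "'a set set \<Rightarrow> bool" where
  "abstract_complex K \<longleftrightarrow> (\<forall>S\<in>K. finite S \<and> (\<forall>T. T \<subseteq> S \<longrightarrow> T \<in> K))"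

lemma abstract_complex_finite: "abstract_complex K \<Longrightarrow> S \<in> K \<Longrightarrow> finite S"
  by (simp add: abstract_complex_def)

lemma abstract_complex_subset: "abstract_complex K \<Longrightarrow> S \<in> K \<Longrightarrow> T \<subseteq> S \<Longrightarrow> T \<in> K"
  by (auto simp: abstract_complex_def)

lemma abstract_complex_avoiding:
  "abstract_complex K \<Longrightarrow> abstract_complex {S \<in> K. \<forall>\<tau>\<in>A. \<not> \<tau> \<subseteq> S}"
  by (fastforce simp: abstract_complex_def)

lemma geometric_realizationI:
  assumes "abstract_complex K" "S \<in> K" "\<And>v. 0 \<le> x v" "\<And>v. v \<notin> S \<Longrightarrow> x v = 0" "sum x S = 1"
  shows "x \<in> geometric_realization K"
proof -
  have sub: "{v. x v \<noteq> 0} \<subseteq> S"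
    using assms(4) by auto
  have "(\<Sum>v | x v \<noteq> 0. x v) = sum x S"
    by (rule sum.mono_neutral_left) (use sub abstract_complex_finite[OF assms(1,2)] in auto)
  with assms sub abstract_complex_subset[OF assms(1,2) sub] show ?thesis
    by (auto simp: geometric_realization_def)
qed

lemma geometric_realization_nonneg: "x \<in> geometric_realization K \<Longrightarrow> 0 \<le> x v"
  by (simp add: geometric_realization_def)

lemma geometric_realization_support: "x \<in> geometric_realization K \<Longrightarrow> {v. x v \<noteq> 0} \<in> K"
  by (simp add: geometric_realization_def)

lemma geometric_realization_sum:
  assumes "x \<in> geometric_realization K" "finite S" "\<And>v. v \<notin> S \<Longrightarrow> x v = 0"
  shows "sum x S = 1"
proof -
  have "(\<Sum>v | x v \<noteq> 0. x v) = sum x S"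
    by (rule sum.mono_neutral_left) (use assms in auto)
  with assms show ?thesis by (simp add: geometric_realization_def)
qed

lemma continuous_on_coordinate:
  "continuous_on A f \<Longrightarrow> continuous_on A (\<lambda>x. f x v)"
  by (rule continuous_on_compose2[OF continuous_on_product_coordinates[of v]]) auto

lemma continuous_on_Min_coordinates:
  assumes "finite T" "T \<noteq> {}"
  shows "continuous_on A (\<lambda>x::'a \<Rightarrow> real. Min (x ` T))"
  using assms
proof (induction rule: finite_ne_induct)
  case (singleton v)
  then show ?case
    by (simp add: continuous_on_coordinate[OF continuous_on_id])
next
  case (insert v F)
  then show ?case
    by (auto intro!: continuous_on_min continuous_on_coordinate[OF continuous_on_id])
qed

text \<open>At time \<open>t\<close> a fraction \<open>t\<close> of the least coordinate over
  \<open>\<tau>\<close> is taken from every vertex of \<open>\<tau>\<close> and the total is given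
  to \<open>w\<close>. At time 1 some vertex of \<open>\<tau>\<close> has lost everything, so the
  support no longer contains \<open>\<tau>\<close>. Points of the smaller realization have least
  coordinate 0 and never move, so a single continuous formula serves everywhere. The path stays in
  the realization of \<open>K\<close> by the apex condition, because only \<open>w\<close> can enter
  the support.\<close>

lemma geometric_realization_collapse:
  fixes K :: "'a set set"
  assumes K: "abstract_complex K" and \<tau>: "finite \<tau>" "\<tau> \<noteq> {}" "w \<notin> \<tau>"
    and apex: "\<And>S. S \<in> K \<Longrightarrow> \<tau> \<subseteq> S \<Longrightarrow> insert w S \<in> K"
  shows "geometric_realization K homotopy_eqv geometric_realization {S \<in> K. \<not> \<tau> \<subseteq> S}"
    (is "?X homotopy_eqv ?Y")
proof -
  define m where "m x = Min (x ` \<tau>)" for x :: "'a \<Rightarrow> real"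
  \<comment> \<open>The direction of motion. The weight at \<open>w\<close> is the number of
    vertices that give up mass, so the coefficients add up to 0 and the coordinate sum stays
    1.\<close>
  define c where "c v = (if v = w then real (card \<tau>) else if v \<in> \<tau> then -1 else 0)" for v
  define h where "h p = (\<lambda>v. snd p v + fst p * m (snd p) * c v)" for p :: "real \<times> ('a \<Rightarrow> real)"
  have K': "abstract_complex {S \<in> K. \<not> \<tau> \<subseteq> S}"
    using abstract_complex_avoiding[OF K, of "{\<tau>}"] by simp
  have m_le: "m x \<le> x v" if "v \<in> \<tau>" for x v
    using that \<tau> by (simp add: m_def)
  have m_ex: "\<exists>v\<in>\<tau>. m x = x v" for x
  proof -
    have "m x \<in> x ` \<tau>"
      unfolding m_def using \<tau> by (intro Min_in) auto
    then show ?thesis by auto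
  qed
  have m_nonneg: "m x \<ge> 0" if "x \<in> ?X" for x
    using m_ex[of x] geometric_realization_nonneg[OF that] by auto
  have nonneg: "h (t, x) v \<ge> 0" if "x \<in> ?X" "t \<in> {0..1}" for t x v
  proof -
    have x: "x v \<ge> 0"
      using geometric_realization_nonneg[OF that(1)] .
    have "t * m x \<le> 1 * m x"
      using that m_nonneg[OF that(1)] by (intro mult_right_mono) auto
    then show ?thesis
      using m_le[of v x] x m_nonneg[OF that(1)] that by (auto simp: h_def c_def)
  qed
  have hX: "h (t, x) \<in> ?X" if "x \<in> ?X" "t \<in> {0..1}" for t x
  proof (cases "m x = 0")
    case True
    then show ?thesis using that by (simp add: h_def)
  next
    case False
    let ?S = "{v. x v \<noteq> 0}"
    have S: "?S \<in> K" "finite ?S"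
      using geometric_realization_support[OF that(1)] abstract_complex_finite[OF K] by auto
    \<comment> \<open>A positive minimum puts all of \<open>\<tau>\<close> into the support, which
      makes the apex condition applicable.\<close>
    have sub: "\<tau> \<subseteq> ?S"
      using m_le[of _ x] False m_nonneg[OF that(1)] by fastforce
    have "sum c (insert w ?S) = sum c (insert w \<tau>)"
      by (rule sum.mono_neutral_right) (use sub S in \<open>auto simp: c_def\<close>)
    also have "\<dots> = real (card \<tau>) + sum c \<tau>"
      using \<tau> by (simp add: c_def)
    also have "sum c \<tau> = sum (\<lambda>_. -1) \<tau>"
      by (rule sum.cong) (use \<tau> in \<open>auto simp: c_def\<close>)
    finally have c0: "sum c (insert w ?S) = 0"
      by simp
    show ?thesis
    proof (rule geometric_realizationI[OF K, of "insert w ?S"])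
      show "insert w ?S \<in> K"
        using apex S(1) sub by blast
      show "h (t, x) v \<ge> 0" for v
        by (rule nonneg[OF that])
      show "h (t, x) v = 0" if "v \<notin> insert w ?S" for v
        using that sub by (auto simp: h_def c_def)
      have "sum (h (t, x)) (insert w ?S) = sum x (insert w ?S) + t * m x * sum c (insert w ?S)"
        by (simp only: h_def fst_conv snd_conv sum.distrib sum_distrib_left)
      also have "sum x (insert w ?S) = 1"
        by (rule geometric_realization_sum[OF that(1)]) (use S(2) in auto)
      finally show "sum (h (t, x)) (insert w ?S) = 1"
        unfolding c0 by simp
    qed
  qed
  have hY: "h (1, x) \<in> ?Y" if "x \<in> ?X" for x
  proof -
    obtain v where v: "v \<in> \<tau>" "m x = x v"
      using m_ex by blast
    then have "h (1, x) v = 0"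
      using \<tau> by (auto simp: h_def c_def)
    then have "\<not> \<tau> \<subseteq> {v. h (1, x) v \<noteq> 0}"
      using v by blast
    then show ?thesis
      using hX[OF that, of 1] by (simp add: geometric_realization_def)
  qed
  have YX: "?Y \<subseteq> ?X"
    by (auto simp: geometric_realization_def)
  have idY: "h (t, x) = x" if xY: "x \<in> ?Y" for t x
  proof -
    obtain v where v: "v \<in> \<tau>" "x v = 0"
      using geometric_realization_support[OF xY] by auto
    then have "m x = 0"
      using m_le[OF v(1), of x] m_nonneg[of x] YX xY by auto
    then show ?thesis
      by (simp add: h_def)
  qed
  have cont: "continuous_on A h" for A
  proof (rule continuous_on_coordinatewise_then_product)
    fix v
    have "continuous_on UNIV m"
      using continuous_on_Min_coordinates[OF \<tau>(1,2)] by (simp add: m_def[abs_def])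
    then have "continuous_on A (\<lambda>p. m (snd p))"
      by (rule continuous_on_compose2) (auto intro: continuous_on_snd continuous_on_id)
    moreover have "continuous_on A (\<lambda>p. snd p v)"
      by (rule continuous_on_coordinate[OF continuous_on_snd[OF continuous_on_id]])
    ultimately show "continuous_on A (\<lambda>p. h p v)"
      unfolding h_def
      by (intro continuous_on_add continuous_on_mult continuous_on_fst continuous_on_id continuous_on_const)
  qed
  have cont1: "continuous_on ?X (\<lambda>x. h (1, x))"
    by (rule continuous_on_compose2[OF cont[of UNIV]])
       (auto intro: continuous_on_Pair continuous_on_const continuous_on_id)
  have "homotopic_with (\<lambda>_. True) (top_of_set ?X) (top_of_set ?X) id (\<lambda>x. h (1, x))"
    unfolding homotopic_with_def
  proof (intro exI[of _ h] conjI)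
    show "continuous_map (prod_topology (top_of_set {0..1}) (top_of_set ?X)) (top_of_set ?X) h"
      using cont hX
      by (auto simp: continuous_map_in_subtopology prod_topology_subtopology_eu)
  qed (auto simp: h_def)
  moreover have "retraction_maps (top_of_set ?X) (top_of_set ?Y) (\<lambda>x. h (1, x)) id"
    using cont1 hY YX idY by (auto simp: retraction_maps_def)
  ultimately show ?thesis
    using deformation_retract_imp_homotopy_equivalent_space homotopic_with_sym by blast
qed

text \<open>No apex lies in a face that is removed, so the removals do not interfere.\<close>

lemma geometric_realization_collapse_family:
  fixes K :: "'a set set"
  assumes K: "abstract_complex K" and "finite A"
    and A: "\<And>\<tau>. \<tau> \<in> A \<Longrightarrow> finite \<tau> \<and> \<tau> \<noteq> {} \<and> w \<tau> \<notin> \<Union>A"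
    and apex: "\<And>S \<tau>. S \<in> K \<Longrightarrow> \<tau> \<in> A \<Longrightarrow> \<tau> \<subseteq> S \<Longrightarrow> insert (w \<tau>) S \<in> K"
  shows "geometric_realization K homotopy_eqv geometric_realization {S \<in> K. \<forall>\<tau>\<in>A. \<not> \<tau> \<subseteq> S}"
proof -
  have "geometric_realization K homotopy_eqv geometric_realization {S \<in> K. \<forall>\<tau>\<in>B. \<not> \<tau> \<subseteq> S}"
    if "finite B" "B \<subseteq> A" for B
    using that
  proof (induction B rule: finite_induct)
    case empty
    then show ?case by (simp add: homotopy_equivalent_space_refl)
  next
    case (insert \<tau> B)
    let ?L = "{S \<in> K. \<forall>\<tau>\<in>B. \<not> \<tau> \<subseteq> S}"
    have "geometric_realization ?L homotopy_eqv geometric_realization {S \<in> ?L. \<not> \<tau> \<subseteq> S}"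
    proof (rule geometric_realization_collapse[where w = "w \<tau>"])
      show "abstract_complex ?L"
        by (rule abstract_complex_avoiding[OF K])
      show "insert (w \<tau>) S \<in> ?L" if "S \<in> ?L" "\<tau> \<subseteq> S" for S
      proof -
        have "\<not> \<sigma> \<subseteq> insert (w \<tau>) S" if "\<sigma> \<in> B" for \<sigma>
          using that insert.prems A[of \<tau>] \<open>S \<in> ?L\<close> by blast
        then show ?thesis
          using apex[of S \<tau>] that insert.prems by blast
      qed
    qed (use insert.prems A[of \<tau>] in auto)
    moreover have "{S \<in> ?L. \<not> \<tau> \<subseteq> S} = {S \<in> K. \<forall>\<tau>\<in>insert \<tau> B. \<not> \<tau> \<subseteq> S}"
      by auto
    ultimately have "geometric_realization ?L homotopy_eqv
        geometric_realization {S \<in> K. \<forall>\<tau>\<in>insert \<tau> B. \<not> \<tau> \<subseteq> S}"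
      by (simp only:)
    with insert.IH show ?case
      by (rule homotopy_eqv_trans) (use insert.prems in auto)
  qed
  from this[OF \<open>finite A\<close>] show ?thesis by blast
qed

section \<open>Contracting a subspace\<close>

text \<open>The support only has to lie in \<open>S\<close>, so that the set is closed and contains
  its faces; continuous maps on a finite complex can then be pasted from closed pieces. For infinite
  \<open>S\<close> the sum is 0 and the set is empty.\<close>

definition closed_simplex :: "'a set \<Rightarrow> ('a \<Rightarrow> real) set" where
  "closed_simplex S = {x. (\<forall>v. 0 \<le> x v) \<and> (\<forall>v. v \<notin> S \<longrightarrow> x v = 0) \<and> sum x S = 1}"

lemma geometric_realization_eq_Union:
  assumes K: "abstract_complex K"
  shows "geometric_realization K = (\<Union>S\<in>K. closed_simplex S)"
proof
  show "geometric_realization K \<subseteq> (\<Union>S\<in>K. closed_simplex S)"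
  proof
    fix x assume x: "x \<in> geometric_realization K"
    then have "x \<in> closed_simplex {v. x v \<noteq> 0}"
      by (auto simp: geometric_realization_def closed_simplex_def)
    then show "x \<in> (\<Union>S\<in>K. closed_simplex S)"
      using geometric_realization_support[OF x] by blast
  qed
  show "(\<Union>S\<in>K. closed_simplex S) \<subseteq> geometric_realization K"
    by (auto simp: closed_simplex_def intro: geometric_realizationI[OF K])
qed

lemma continuous_on_sum_coordinates: "continuous_on UNIV (\<lambda>x::'a \<Rightarrow> real. sum x S)"
  by (intro continuous_on_sum continuous_on_coordinate[OF continuous_on_id])

lemma closed_closed_simplex: "closed (closed_simplex S)"
proof -
  have c: "continuous_on UNIV (\<lambda>x::'a \<Rightarrow> real. x v)" for v
    by (rule continuous_on_coordinate[OF continuous_on_id])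
  have "closed_simplex S = (\<Inter>v. {x. 0 \<le> x v}) \<inter> (\<Inter>v\<in>-S. {x. x v = 0}) \<inter> {x. sum x S = 1}"
    by (auto simp: closed_simplex_def)
  moreover have "closed \<dots>"
    by (intro closed_Int closed_INT ballI closed_Collect_le closed_Collect_eq c
        continuous_on_const continuous_on_sum_coordinates)
  ultimately show ?thesis by simp
qed

text \<open>A closed subset of a cube, which is compact by Tychonoff even when the type of vertices
  is infinite.\<close>

lemma compact_closed_simplex:
  assumes "finite S"
  shows "compact (closed_simplex S)"
proof -
  have "compact (PiE UNIV (\<lambda>_::'a. {0..1::real}))"
  proof -
    have "compactin (product_topology (\<lambda>_::'a. euclideanreal) UNIV) (PiE UNIV (\<lambda>_. {0..1}))"
      by (simp only: compactin_PiE) auto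
    then show ?thesis
      by (simp add: euclidean_product_topology)
  qed
  moreover have "closed_simplex S \<subseteq> PiE UNIV (\<lambda>_. {0..1})"
  proof
    fix x assume x: "x \<in> closed_simplex S"
    have "x v \<le> 1" for v
    proof (cases "v \<in> S")
      case True
      have "x v \<le> sum x S"
        by (rule member_le_sum) (use True x assms in \<open>auto simp: closed_simplex_def\<close>)
      then show ?thesis using x by (simp add: closed_simplex_def)
    next
      case False
      then show ?thesis using x by (simp add: closed_simplex_def)
    qed
    then show "x \<in> PiE UNIV (\<lambda>_. {0..1})"
      using x by (auto simp: closed_simplex_def)
  qed
  ultimately show ?thesis
    using compact_Int_closed[OF _ closed_closed_simplex, of _ S] by (metis inf.absorb2)
qed

lemma compact_geometric_realization:
  assumes "abstract_complex K" "finite K"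
  shows "compact (geometric_realization K)"
  unfolding geometric_realization_eq_Union[OF assms(1)]
  using assms by (auto intro!: compact_UN compact_closed_simplex abstract_complex_finite)

lemma closed_geometric_realization:
  assumes "abstract_complex K" "finite K"
  shows "closed (geometric_realization K)"
  unfolding geometric_realization_eq_Union[OF assms(1)]
  using assms by (auto intro!: closed_UN closed_closed_simplex)

text \<open>\<open>F\<close> identifies the points of \<open>A\<close> and nothing else, so by
  compactness \<open>W\<close> is the quotient of \<open>X\<close> by \<open>A\<close>.
  \<open>H\<close> moves \<open>A\<close> within itself to a point; hence its final map factors
  through \<open>F\<close> as \<open>g\<close>, and \<open>H\<close> joins the identity to
  \<open>g \<circ> F\<close>. The homotopy \<open>k\<close> that \<open>H\<close> induces on
  \<open>W\<close> joins the identity to \<open>F \<circ> g\<close>.\<close>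

lemma homotopy_eqv_collapse_contractible:
  fixes X :: "'a::topological_space set" and W :: "'b::metric_space set"
  assumes X: "compact X" and F: "continuous_on X F" "F ` X = W"
    and F_eq: "\<And>x y. x \<in> X \<Longrightarrow> y \<in> X \<Longrightarrow> F x = F y \<Longrightarrow> x = y \<or> x \<in> A \<and> y \<in> A"
    and F_A: "\<And>x y. x \<in> A \<Longrightarrow> y \<in> A \<Longrightarrow> F x = F y"
    and H: "continuous_on ({0..1::real} \<times> X) H" "H ` ({0..1} \<times> X) \<subseteq> X"
    and H0: "\<And>x. x \<in> X \<Longrightarrow> H (0, x) = x"
    and HA: "\<And>t x. t \<in> {0..1} \<Longrightarrow> x \<in> A \<Longrightarrow> H (t, x) \<in> A"
    and H1: "\<And>x y. x \<in> A \<Longrightarrow> y \<in> A \<Longrightarrow> H (1, x) = H (1, y)"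
  shows "X homotopy_eqv W"
proof -
  let ?I = "top_of_set {0..1::real}" and ?X = "top_of_set X" and ?W = "top_of_set W"
  have Fmap: "continuous_map ?X ?W F"
    using F by auto
  have Hmap: "continuous_map (prod_topology ?I ?X) ?X H"
    using H by (auto simp: continuous_map_in_subtopology)
  have Fq: "quotient_map ?X ?W F"
    by (rule T1_Spaces.continuous_imp_quotient_map[OF Fmap])
       (use X F in \<open>auto simp: compact_space_subtopology Hausdorff_space_subtopology\<close>)
  let ?F = "\<lambda>(t, x). (t, F x)"
  \<comment> \<open>The product with the interval is again a quotient map, being a continuous
    surjection from a compact space onto a Hausdorff space; this is what makes the induced homotopy
    on \<open>W\<close> continuous.\<close>
  have "quotient_map (prod_topology ?I ?X) (prod_topology ?I ?W) ?F"
  proof (rule T1_Spaces.continuous_imp_quotient_map)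
    show "continuous_map (prod_topology ?I ?X) (prod_topology ?I ?W) ?F"
      using continuous_map_prod_top[of ?I ?X ?I ?W "\<lambda>t. t" F] Fmap
      by simp
    show "compact_space (prod_topology ?I ?X)"
      using X by (simp add: compact_space_subtopology compact_Times)
    show "Hausdorff_space (prod_topology ?I ?W)"
      by (simp add: Hausdorff_space_subtopology)
    show "?F ` topspace (prod_topology ?I ?X) = topspace (prod_topology ?I ?W)"
      using F(2) by (force simp: image_iff)
  qed
  then obtain k where k: "continuous_map (prod_topology ?I ?W) ?W k"
      and "\<And>p. p \<in> topspace (prod_topology ?I ?X) \<Longrightarrow> k (?F p) = (F \<circ> H) p"
  proof (rule quotient_map_lift_exists)
    show "continuous_map (prod_topology ?I ?X) ?W (F \<circ> H)"
      by (rule continuous_map_compose[OF Hmap Fmap])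
    show "(F \<circ> H) p = (F \<circ> H) q"
      if pq: "p \<in> topspace (prod_topology ?I ?X)" "q \<in> topspace (prod_topology ?I ?X)" "?F p = ?F q"
      for p q
    proof -
      obtain t x y where eq: "p = (t, x)" "q = (t, y)" "F x = F y" "t \<in> {0..1}" "x \<in> X" "y \<in> X"
        using pq by (cases p, cases q) auto
      \<comment> \<open>Points identified by \<open>F\<close> agree or both lie in \<open>A\<close>;
        in the second case \<open>H\<close> keeps them in \<open>A\<close>, so \<open>F\<close>
        still identifies them at time \<open>t\<close>.\<close>
      then have "x = y \<or> x \<in> A \<and> y \<in> A"
        using F_eq by blast
      then show ?thesis
        using F_A[OF HA[OF \<open>t \<in> {0..1}\<close>] HA[OF \<open>t \<in> {0..1}\<close>], of x y] eq(1,2) by force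
    qed
  qed auto
  then have k_eq: "k (t, F x) = F (H (t, x))" if "t \<in> {0..1}" "x \<in> X" for t x
    using that by fastforce
  have "continuous_map ?X ?X (H \<circ> Pair 1)"
    using Hmap by (rule continuous_map_o_Pair) simp
  then obtain g where g: "continuous_map ?W ?X g"
    and "\<And>x. x \<in> topspace ?X \<Longrightarrow> g (F x) = (H \<circ> Pair 1) x"
  proof (rule quotient_map_lift_exists[OF Fq])
    show "(H \<circ> Pair 1) x = (H \<circ> Pair 1) y"
      if "x \<in> topspace ?X" "y \<in> topspace ?X" "F x = F y" for x y
      using F_eq[of x y] that H1[of x y] by auto
  qed auto
  then have g_eq: "g (F x) = H (1, x)" if "x \<in> X" for x
    using that by simp
  have "homotopic_with (\<lambda>_. True) ?X ?X id (g \<circ> F)"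
    by (subst homotopic_with) (use Hmap H0 g_eq in auto)
  moreover have "homotopic_with (\<lambda>_. True) ?W ?W id (F \<circ> g)"
  proof (subst homotopic_with)
    have "k (0, w) = w \<and> k (1, w) = F (g w)" if "w \<in> W" for w
    proof -
      obtain x where "x \<in> X" "w = F x"
        using \<open>w \<in> W\<close> F(2) by blast
      then show ?thesis
        using k_eq[of 0 x] k_eq[of 1 x] H0 g_eq by simp
    qed
    with k show "\<exists>h. continuous_map (prod_topology ?I ?W) ?W h \<and>
        (\<forall>x\<in>topspace ?W. h (0, x) = id x) \<and> (\<forall>x\<in>topspace ?W. h (1, x) = (F \<circ> g) x) \<and>
        (\<forall>t\<in>{0..1}. True)"
      by (intro exI[of _ k]) auto
  qed auto
  ultimately show ?thesis
    using Fmap g unfolding homotopy_equivalent_space_def by (meson homotopic_with_sym)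
qed

section \<open>Connected graphs are wedges of circles\<close>

text \<open>Besides points of an edge this also names vertices: \<open>edge_point v v 0\<close> is
  the vertex \<open>v\<close>, since the first test of the conditional wins.\<close>

definition edge_point :: "'a \<Rightarrow> 'a \<Rightarrow> real \<Rightarrow> 'a \<Rightarrow> real" where
  "edge_point p q u = (\<lambda>v. if v = p then 1 - u else if v = q then u else 0)"

lemma closed_simplex_pairD:
  assumes "x \<in> closed_simplex {p, q}" "p \<noteq> q"
  shows "x = edge_point p q (x q)" "0 \<le> x q" "x q \<le> 1" "x p = 1 - x q"
proof -
  have x: "\<And>v. 0 \<le> x v" "\<And>v. v \<notin> {p, q} \<Longrightarrow> x v = 0" "x p + x q = 1"
    using assms by (auto simp: closed_simplex_def)
  show "0 \<le> x q" "x q \<le> 1" "x p = 1 - x q"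
    using x(1)[of p] x(1)[of q] x(3) by auto
  then show "x = edge_point p q (x q)"
    using x(2) by (auto simp: edge_point_def fun_eq_iff)
qed

lemma edge_point_in_closed_simplex:
  "p \<noteq> q \<Longrightarrow> 0 \<le> u \<Longrightarrow> u \<le> 1 \<Longrightarrow> edge_point p q u \<in> closed_simplex {p, q}"
  by (auto simp: closed_simplex_def edge_point_def)

lemma edge_point_0: "edge_point p q 0 = edge_point p p 0"
  by (auto simp: edge_point_def)

lemma edge_point_1: "p \<noteq> q \<Longrightarrow> edge_point p q 1 = edge_point q q 0"
  by (auto simp: edge_point_def)

lemma continuous_on_edge_point: "continuous_on A (edge_point p q)"
proof (rule continuous_on_coordinatewise_then_product)
  show "continuous_on A (\<lambda>u. edge_point p q u v)" for v
    by (cases "v = p"; cases "v = q") (auto simp: edge_point_def intro!: continuous_intros)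
qed

lemma vertex_in_geometric_realization:
  assumes "abstract_complex K" "{v} \<in> K"
  shows "edge_point v v 0 \<in> geometric_realization K"
  by (rule geometric_realizationI[OF assms]) (auto simp: edge_point_def)

lemma missing_edge_vanishes:
  assumes "abstract_complex C" "x \<in> geometric_realization C" "{p, q} \<notin> C"
  shows "x p = 0 \<or> x q = 0"
proof (rule ccontr)
  assume "\<not> ?thesis"
  then have "{p, q} \<subseteq> {v. x v \<noteq> 0}" by auto
  then show False
    using assms abstract_complex_subset geometric_realization_support by metis
qed

lemma other_edge_vanishes:
  assumes "x \<in> closed_simplex {p, q}" "r \<noteq> s" "{r, s} \<noteq> {p, q}"
  shows "x r = 0 \<or> x s = 0"
proof (rule ccontr)
  assume "\<not> ?thesis"
  then have "r \<in> {p, q}" "s \<in> {p, q}"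
    using assms(1) by (auto simp: closed_simplex_def)
  then show False
    using assms(2,3) by auto
qed

section \<open>Spanning trees\<close>

lemma rtrancl_leaves_set:
  assumes "(a, b) \<in> R\<^sup>*" "a \<in> U" "b \<notin> U"
  obtains x y where "(x, y) \<in> R" "x \<in> U" "y \<notin> U"
proof -
  have "b \<in> U" if "\<And>x y. (x, y) \<in> R \<Longrightarrow> x \<in> U \<Longrightarrow> y \<in> U"
    using assms(1,2) by (induction rule: rtrancl_induct) (use that in auto)
  then show ?thesis
    using assms(3) that by blast
qed

text \<open>Plays the part of a spanning tree, with contractibility instead of acyclicity as the
  invariant, since that is what the quotient argument asks for. Among the contractible subcomplexes
  containing \<open>v0\<close>, one with the most simplices reaches every vertex: an edge leading
  out of it could be added together with its far end.\<close>

lemma contractible_spanning_subcomplex: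
  assumes K: "abstract_complex K" "finite K" and v0: "{v0} \<in> K"
    and conn: "\<And>v. {v} \<in> K \<Longrightarrow> (v0, v) \<in> {(x, y). {x, y} \<in> K}\<^sup>*"
  obtains C where "abstract_complex C" "C \<subseteq> K" "contractible (geometric_realization C)"
    "\<And>v. {v} \<in> K \<Longrightarrow> {v} \<in> C"
proof -
  define P where "P C \<longleftrightarrow> abstract_complex C \<and> C \<subseteq> K \<and>
    contractible (geometric_realization C) \<and> {v0} \<in> C" for C
  let ?C0 = "{{}, {v0}}"
  have C0: "abstract_complex ?C0"
    by (auto simp: abstract_complex_def)
  have "x = edge_point v0 v0 0" if x: "x \<in> geometric_realization ?C0" for x
  proof -
    have 0: "x v = 0" if "v \<noteq> v0" for v
      using geometric_realization_support[OF x] that by auto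
    moreover have "x v0 = 1"
      using geometric_realization_sum[OF x, of "{v0}"] 0 by simp
    ultimately show ?thesis
      unfolding edge_point_def by (intro ext) simp
  qed
  then have "geometric_realization ?C0 = {edge_point v0 v0 0}"
    using vertex_in_geometric_realization[OF C0, of v0] by blast
  moreover have "contractible {edge_point v0 v0 0}"
    unfolding contractible_def
    by (intro exI[of _ "edge_point v0 v0 0"] homotopic_with_equal) auto
  moreover have "{} \<in> K"
    using abstract_complex_subset[OF K(1) v0] by auto
  ultimately have "P ?C0"
    using C0 v0 by (simp add: P_def)
  moreover have "\<forall>C. P C \<longrightarrow> card C < Suc (card K)"
    using K(2) by (auto simp: P_def less_Suc_eq_le intro: card_mono)
  ultimately obtain C where C: "P C" and max: "\<And>D. P D \<Longrightarrow> card D \<le> card C"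
    using ex_has_greatest_nat[of P ?C0 card "Suc (card K)"] by blast
  have "{v} \<in> C" if v: "{v} \<in> K" for v
  proof (rule ccontr)
    assume "{v} \<notin> C"
    then obtain x y where xy: "{x, y} \<in> K" "{x} \<in> C" "{y} \<notin> C"
      using rtrancl_leaves_set[OF conn[OF v], of "{v. {v} \<in> C}"] C by (auto simp: P_def)
    define D where "D = insert {y} (insert {x, y} C)"
    have Cc: "abstract_complex C"
      using C by (simp add: P_def)
    have y: "y \<notin> S" if "S \<in> C" for S
      using xy(3) abstract_complex_subset[OF Cc that] by blast
    have "{} \<in> C"
      using abstract_complex_subset[OF Cc xy(2)] by blast
    have D: "abstract_complex D"
      unfolding abstract_complex_def
    proof (intro ballI conjI allI impI)
      fix S assume S: "S \<in> D"
      then show "finite S"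
        using abstract_complex_finite[OF Cc] by (auto simp: D_def)
      fix T assume T: "T \<subseteq> S"
      show "T \<in> D"
      proof (cases "S \<in> C")
        case True
        then show ?thesis
          using abstract_complex_subset[OF Cc _ T] by (simp add: D_def)
      next
        case False
        then have "T \<subseteq> {x, y}"
          using S T by (auto simp: D_def)
        then have "T = {} \<or> T = {x} \<or> T = {y} \<or> T = {x, y}"
          by blast
        then show ?thesis
          using xy(2) \<open>{} \<in> C\<close> by (auto simp: D_def)
      qed
    qed
    \<comment> \<open>The only new simplices are \<open>{y}\<close> and \<open>{x, y}\<close>, so
      \<open>x\<close> is an apex for \<open>{y}\<close> and the whisker collapses back to
      \<open>C\<close>.\<close>
    have "geometric_realization D homotopy_eqv geometric_realization {S \<in> D. \<not> {y} \<subseteq> S}"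
    proof (rule geometric_realization_collapse[OF D, where w = x])
      show "x \<notin> {y}"
        using xy by auto
      show "insert x S \<in> D" if "S \<in> D" "{y} \<subseteq> S" for S
        using that y by (auto simp: D_def insert_absorb)
    qed auto
    moreover have "{S \<in> D. \<not> {y} \<subseteq> S} = C"
      using y by (auto simp: D_def)
    ultimately have "contractible (geometric_realization D)"
      using C homotopy_equivalent_space_contractibility contractible_space_top_of_set
      unfolding P_def by metis
    moreover have "D \<subseteq> K"
      using C xy(1) abstract_complex_subset[OF K(1) xy(1)] by (auto simp: D_def P_def)
    ultimately have "P D"
      using D C by (auto simp: P_def D_def)
    moreover have "card C < card D"
      using xy(3) \<open>D \<subseteq> K\<close> K(2) by (intro psubset_card_mono) (auto simp: D_def finite_subset)
    ultimately show False
      using max[of D] by simp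
  qed
  with C show ?thesis
    using that by (auto simp: P_def)
qed

text \<open>For \<open>a + b = 1\<close> the point \<open>(1 - 8ab, 4(a - b) \<surd>(ab))\<close> runs once around the unit circle, and for
  \<open>ab = 0\<close> it is the base point. With \<open>a\<close> and \<open>b\<close> the barycentric coordinates of the ends of an edge,
  it is therefore constant off that edge and continuous on the whole complex.\<close>

definition circle_point :: "real \<Rightarrow> real \<Rightarrow> complex" where
  "circle_point a b = Complex (1 - 8 * (a * b)) (4 * (a - b) * sqrt (a * b))"

lemma circle_point_eq_1_iff: "circle_point a b = 1 \<longleftrightarrow> a * b = 0"
  by (auto simp: circle_point_def complex_eq_iff)

lemma norm_circle_point:
  assumes "0 \<le> a" "0 \<le> b" "a + b = 1"
  shows "norm (circle_point a b) = 1"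
proof -
  have b: "b = 1 - a" using assms by simp
  have "(sqrt (a * b))\<^sup>2 = a * b"
    using assms by simp
  then have "(4 * (a - b) * sqrt (a * b))\<^sup>2 = 16 * (a - b)\<^sup>2 * (a * b)"
    by (simp only: power_mult_distrib) simp
  then have "(1 - 8 * (a * b))\<^sup>2 + (4 * (a - b) * sqrt (a * b))\<^sup>2 = 1"
    unfolding b by (simp add: power2_eq_square algebra_simps)
  then show ?thesis
    by (simp add: circle_point_def cmod_def)
qed

text \<open>The real part determines \<open>a * b\<close>; this is nonzero away from the base point,
  so the imaginary part then determines \<open>a - b\<close>.\<close>

lemma circle_point_inj:
  assumes "a + b = 1" "c + d = 1" "circle_point a b = circle_point c d" "circle_point a b \<noteq> 1"
  shows "b = d"
proof -
  have ab: "a * b = c * d" "(a - b) * sqrt (a * b) = (c - d) * sqrt (c * d)"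
    using assms(3) by (auto simp: circle_point_def)
  then have "a - b = c - d"
    using assms(4) by (simp add: circle_point_eq_1_iff)
  then show ?thesis
    using assms(1,2) by linarith
qed

lemma circle_point_surj:
  assumes "norm z = 1"
  obtains u where "0 \<le> u" "u \<le> 1" "circle_point (1 - u) u = z"
proof -
  have z: "(Re z)\<^sup>2 + (Im z)\<^sup>2 = 1"
    using assms by (simp add: cmod_def)
  have re: "\<bar>Re z\<bar> \<le> 1"
    using assms abs_Re_le_cmod[of z] by simp
  \<comment> \<open>Solving \<open>1 - 8 * (a * b) = Re z\<close> with \<open>a + b = 1\<close>
    gives \<open>(1 + Re z) / 2\<close> for the square of \<open>a - b\<close>. So \<open>s\<close>
    is the absolute value of \<open>a - b\<close>, the sign \<open>\<sigma>\<close> of the imaginary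
    part selects the half of the circle, and \<open>u\<close> solves
    \<open>1 - 2 * u = \<sigma> * s\<close>.\<close>
  define \<sigma> where "\<sigma> = (if Im z \<ge> 0 then 1 else -1 :: real)"
  define s where "s = sqrt ((1 + Re z) / 2)"
  have s: "s\<^sup>2 = (1 + Re z) / 2" "0 \<le> s" "s \<le> 1"
    using re by (auto simp: s_def)
  have \<sigma>: "\<sigma>\<^sup>2 = 1" "\<sigma> * \<bar>Im z\<bar> = Im z"
    by (auto simp: \<sigma>_def)
  define u where "u = (1 - \<sigma> * s) / 2"
  have "(1 - u) * u = (1 - \<sigma>\<^sup>2 * s\<^sup>2) / 4"
    unfolding u_def by (simp add: power2_eq_square field_simps)
  then have P: "(1 - u) * u = (1 - Re z) / 8"
    using s \<sigma> by (simp add: field_simps)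
  have "(sqrt ((1 - Re z) / 8))\<^sup>2 = (1 - Re z) / 8"
    using re by simp
  then have "(4 * s * sqrt ((1 - Re z) / 8))\<^sup>2 = 16 * ((1 + Re z) / 2) * ((1 - Re z) / 8)"
    by (simp only: power_mult_distrib s(1)) simp
  also have "\<dots> = \<bar>Im z\<bar>\<^sup>2"
    using z by (simp add: power2_eq_square field_simps)
  finally have "4 * s * sqrt ((1 - Re z) / 8) = \<bar>Im z\<bar>"
    by (rule power2_eq_imp_eq) (use s re in auto)
  then have "4 * (1 - u - u) * sqrt ((1 - u) * u) = Im z"
    unfolding P using \<sigma>(2) by (simp add: u_def algebra_simps)
  then have "circle_point (1 - u) u = z"
    unfolding circle_point_def P by (simp add: complex_eq_iff field_simps)
  moreover have "0 \<le> u" "u \<le> 1"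
    using s by (auto simp: u_def \<sigma>_def)
  ultimately show ?thesis
    using that by blast
qed

section \<open>Homotopy extension over the edges outside a subcomplex\<close>

lemma geometric_realization_mono: "C \<subseteq> K \<Longrightarrow> geometric_realization C \<subseteq> geometric_realization K"
  by (auto simp: geometric_realization_def)

lemma geometric_realization_split:
  assumes "abstract_complex C" "abstract_complex K" "C \<subseteq> K"
  shows "geometric_realization K = geometric_realization C \<union> (\<Union>S\<in>K - C. closed_simplex S)"
  using assms(3)
  by (auto simp: geometric_realization_eq_Union[OF assms(1)] geometric_realization_eq_Union[OF assms(2)])

lemma closed_simplex_pair_endpoints:
  assumes "x \<in> closed_simplex {p, q}" "p \<noteq> q" "x p = 0 \<or> x q = 0"
  shows "x q = 0 \<and> x = edge_point p p 0 \<or> x q = 1 \<and> x = edge_point q q 0"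
  using closed_simplex_pairD[OF assms(1,2)] assms(2,3) edge_point_0[of p q] edge_point_1[of p q]
  by fastforce

text \<open>On an edge from \<open>p\<close> to \<open>q\<close> outside \<open>C\<close> the interval \<open>[0, 1]\<close> is stretched to \<open>[-t, 1 + t]\<close>;
  the two overhanging ends follow the tracks of \<open>p\<close> and \<open>q\<close> under \<open>h\<close>.\<close>

lemma extend_homotopy_over_edges:
  fixes h :: "real \<times> ('a \<Rightarrow> real) \<Rightarrow> ('a \<Rightarrow> real)"
  assumes C: "abstract_complex C" and K: "abstract_complex K" "finite K" and CK: "C \<subseteq> K"
    and edges: "\<And>S. S \<in> K - C \<Longrightarrow> card S = 2" and verts: "\<And>v. {v} \<in> K \<Longrightarrow> {v} \<in> C"
    and h: "continuous_on ({0..1} \<times> geometric_realization C) h"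
      "\<And>t x. t \<in> {0..1} \<Longrightarrow> x \<in> geometric_realization C \<Longrightarrow> h (t, x) \<in> geometric_realization C"
      "\<And>x. x \<in> geometric_realization C \<Longrightarrow> h (0, x) = x"
  obtains H where "continuous_on ({0..1} \<times> geometric_realization K) H"
    "\<And>t x. t \<in> {0..1} \<Longrightarrow> x \<in> geometric_realization K \<Longrightarrow> H (t, x) \<in> geometric_realization K"
    "\<And>x. x \<in> geometric_realization K \<Longrightarrow> H (0, x) = x"
    "\<And>t x. x \<in> geometric_realization C \<Longrightarrow> H (t, x) = h (t, x)"
proof -
  let ?A = "geometric_realization C" and ?X = "geometric_realization K"
  let ?pt = "\<lambda>v. edge_point v v 0"
  have "\<exists>p q. S = {p, q} \<and> p \<noteq> q" if "S \<in> K - C" for S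
    using edges[OF that] by (auto simp: card_2_iff)
  then obtain p q where pq: "\<And>S. S \<in> K - C \<Longrightarrow> S = {p S, q S}" "\<And>S. S \<in> K - C \<Longrightarrow> p S \<noteq> q S"
    by metis
  have ptA: "?pt (p S) \<in> ?A" "?pt (q S) \<in> ?A" if "S \<in> K - C" for S
  proof -
    have "{p S} \<subseteq> S" "{q S} \<subseteq> S"
      using pq(1)[OF that] by blast+
    then have "{p S} \<in> C" "{q S} \<in> C"
      using verts abstract_complex_subset[OF K(1)] that by blast+
    then show "?pt (p S) \<in> ?A" "?pt (q S) \<in> ?A"
      by (auto intro: vertex_in_geometric_realization[OF C])
  qed
  define \<gamma> where "\<gamma> S u = (if u \<le> 0 then h (- u, ?pt (p S)) else
    if u \<le> 1 then edge_point (p S) (q S) u else h (u - 1, ?pt (q S)))" for S u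
  \<comment> \<open>\<open>h\<close> is the identity at time 0, so the pieces of
    \<open>\<gamma>\<close> agree at 0 and 1 and each formula holds on a closed interval, as pasting
    requires.\<close>
  have \<gamma>1: "\<gamma> S u = edge_point (p S) (q S) u" if "S \<in> K - C" "u \<in> {0..1}" for S u
    using that h(3)[OF ptA(1)[OF that(1)]] edge_point_0[of "p S" "q S"] by (cases "u = 0") (auto simp: \<gamma>_def)
  have \<gamma>2: "\<gamma> S u = h (u - 1, ?pt (q S))" if "S \<in> K - C" "u \<in> {1..2}" for S u
    using that h(3)[OF ptA(2)[OF that(1)]] edge_point_1[OF pq(2)[OF that(1)]]
    by (cases "u = 1") (auto simp: \<gamma>_def)
  have cont_\<gamma>: "continuous_on {-1..2} (\<gamma> S)" if S: "S \<in> K - C" for S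
  proof -
    have "continuous_on {-1..0} (\<lambda>u. h (- u, ?pt (p S)))"
      by (rule continuous_on_compose2[OF h(1)]) (use ptA[OF S] in \<open>auto intro!: continuous_intros\<close>)
    then have 1: "continuous_on {-1..0} (\<gamma> S)"
      by (rule continuous_on_eq) (auto simp: \<gamma>_def)
    have 2: "continuous_on {0..1} (\<gamma> S)"
      by (rule continuous_on_eq[OF continuous_on_edge_point]) (simp add: \<gamma>1[OF S])
    have "continuous_on {1..2} (\<lambda>u. h (u - 1, ?pt (q S)))"
      by (rule continuous_on_compose2[OF h(1)]) (use ptA[OF S] in \<open>auto intro!: continuous_intros\<close>)
    then have 3: "continuous_on {1..2} (\<gamma> S)"
      by (rule continuous_on_eq) (simp add: \<gamma>2[OF S])
    have "continuous_on ({-1..0} \<union> ({0..1} \<union> {1..2})) (\<gamma> S)"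
      by (intro continuous_on_closed_Un 1 2 3) auto
    moreover have "{-1..0} \<union> ({0..1} \<union> {1..2}) = {-1..2::real}"
      by auto
    ultimately show ?thesis by simp
  qed
  have \<gamma>X: "\<gamma> S u \<in> ?X" if S: "S \<in> K - C" and u: "u \<in> {-1..2}" for S u
  proof -
    have AX: "?A \<subseteq> ?X"
      by (rule geometric_realization_mono[OF CK])
    consider "u \<le> 0" | "u \<in> {0..1}" | "u \<in> {1..2}"
      using u by fastforce
    then show ?thesis
    proof cases
      case 1
      then have "\<gamma> S u \<in> ?A"
        using h(2)[OF _ ptA(1)[OF S], of "-u"] u by (simp add: \<gamma>_def)
      then show ?thesis using AX by blast
    next
      case 2
      then have "\<gamma> S u \<in> closed_simplex S"
        using edge_point_in_closed_simplex[OF pq(2)[OF S]] pq(1)[OF S] \<gamma>1[OF S] by auto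
      then show ?thesis
        using S by (auto simp: geometric_realization_eq_Union[OF K(1)])
    next
      case 3
      then have "\<gamma> S u \<in> ?A"
        using h(2)[OF _ ptA(2)[OF S], of "u - 1"] \<gamma>2[OF S 3] by simp
      then show ?thesis using AX by blast
    qed
  qed
  define u where "u S t x = x (q S) * (1 + 2 * t) - t" for S t and x :: "'a \<Rightarrow> real"
  define H where "H = (\<lambda>(t, x). if x \<in> ?A then h (t, x) else
    let S = (SOME S. S \<in> K - C \<and> x \<in> closed_simplex S) in \<gamma> S (u S t x))"
  have q01: "x (q S) \<in> {0..1}" and x_eq: "x = edge_point (p S) (q S) (x (q S))"
    if "S \<in> K - C" "x \<in> closed_simplex S" for S x
    using closed_simplex_pairD[of x "p S" "q S"] pq that by auto
  have u_range: "u S t x \<in> {-1..2}" if "S \<in> K - C" "x \<in> closed_simplex S" "t \<in> {0..1}" for S t x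
  proof -
    have "0 \<le> x (q S) * (1 + 2 * t)" "x (q S) * (1 + 2 * t) \<le> 1 + 2 * t"
      using q01[OF that(1,2)] that(3) by (auto intro!: mult_left_le_one_le)
    moreover have "0 \<le> t" "t \<le> 1"
      using that(3) by auto
    ultimately have "-1 \<le> u S t x" "u S t x \<le> 2"
      unfolding u_def by linarith+
    then show ?thesis
      by simp
  qed
  \<comment> \<open>The branches of \<open>H\<close> agree where they overlap: an edge outside
    \<open>C\<close> meets the realization of \<open>C\<close> only in its ends, whose parameters
    are \<open>- t\<close> and \<open>1 + t\<close>, where \<open>\<gamma>\<close> follows their
    tracks under \<open>h\<close>. Away from \<open>C\<close> the edge through \<open>x\<close> is
    unique, so the choice in \<open>H\<close> is harmless.\<close>
  have H_edge: "H (t, x) = \<gamma> S (u S t x)"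
    if S: "S \<in> K - C" "x \<in> closed_simplex S" and t: "t \<in> {0..1}" for S t x
  proof (cases "x \<in> ?A")
    case True
    then have "x (p S) = 0 \<or> x (q S) = 0"
      using missing_edge_vanishes[OF C True, of "p S" "q S"] pq(1)[OF S(1)] S(1) by auto
    then consider "x (q S) = 0" "x = ?pt (p S)" | "x (q S) = 1" "x = ?pt (q S)"
      using closed_simplex_pair_endpoints[of x "p S" "q S"] pq[OF S(1)] S(2) by auto
    then show ?thesis
    proof cases
      case 1
      then have "u S t x = - t"
        by (simp add: u_def)
      then show ?thesis
        using True t 1(2) by (simp add: H_def \<gamma>_def)
    next
      case 2
      then have "u S t x = 1 + t"
        by (simp add: u_def)
      then show ?thesis
        using True t \<gamma>2[OF S(1), of "1 + t"] 2(2) by (simp add: H_def)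
    qed
  next
    case False
    have uniq: "T = S" if T: "T \<in> K - C" "x \<in> closed_simplex T" for T
    proof (rule ccontr)
      assume "T \<noteq> S"
      then have "x (p S) = 0 \<or> x (q S) = 0"
        using other_edge_vanishes[of x "p T" "q T" "p S" "q S"] pq[OF S(1)] pq[OF T(1)] T(2) by auto
      then have "x = ?pt (p S) \<or> x = ?pt (q S)"
        using closed_simplex_pair_endpoints[of x "p S" "q S"] pq[OF S(1)] S(2) by auto
      then show False
        using ptA[OF S(1)] False by auto
    qed
    have "(SOME T. T \<in> K - C \<and> x \<in> closed_simplex T) = S"
      by (rule some_equality) (use S uniq in blast)+
    then show ?thesis
      using False by (simp add: H_def Let_def)
  qed
  show ?thesis
  proof (rule that[of H])
    have split: "?X = ?A \<union> (\<Union>S\<in>K - C. closed_simplex S)"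
      by (rule geometric_realization_split[OF C K(1) CK])
    have "continuous_on ({0..1} \<times> ?A) H"
      by (rule continuous_on_eq[OF h(1)]) (auto simp: H_def)
    moreover have "continuous_on (\<Union>S\<in>K - C. {0..1} \<times> closed_simplex S) H"
    proof (rule continuous_on_closed_Union)
      fix S assume S: "S \<in> K - C"
      show "closed ({0..1::real} \<times> closed_simplex S)"
        by (intro closed_Times closed_closed_simplex) auto
      have q: "continuous_on UNIV (\<lambda>z::real \<times> ('a \<Rightarrow> real). snd z (q S))"
        by (rule continuous_on_coordinate[OF continuous_on_snd[OF continuous_on_id]])
      have "continuous_on UNIV (\<lambda>z::real \<times> ('a \<Rightarrow> real). u S (fst z) (snd z))"
        unfolding u_def
        by (intro continuous_on_diff continuous_on_mult continuous_on_add q continuous_on_const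
            continuous_on_fst continuous_on_id)
      then have "continuous_on ({0..1} \<times> closed_simplex S) (\<lambda>z. u S (fst z) (snd z))"
        by (rule continuous_on_subset) simp
      then have "continuous_on ({0..1} \<times> closed_simplex S) (\<lambda>z. \<gamma> S (u S (fst z) (snd z)))"
        by (rule continuous_on_compose2[OF cont_\<gamma>[OF S]]) (use u_range[OF S] in auto)
      then show "continuous_on ({0..1} \<times> closed_simplex S) H"
        by (rule continuous_on_eq) (use H_edge[OF S] in auto)
    qed (use K in auto)
    ultimately have "continuous_on ({0..1} \<times> ?A \<union> (\<Union>S\<in>K - C. {0..1} \<times> closed_simplex S)) H"
      using K CK finite_subset
      by (intro continuous_on_closed_Un closed_UN closed_Times closed_closed_simplex
          closed_geometric_realization[OF C] ballI) auto
    moreover have "{0..1} \<times> ?A \<union> (\<Union>S\<in>K - C. {0..1} \<times> closed_simplex S) = {0..1::real} \<times> ?X"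
      unfolding split by blast
    ultimately show "continuous_on ({0..1} \<times> ?X) H"
      by simp
    show "H (t, x) = h (t, x)" if "x \<in> ?A" for t x
      using that by (simp add: H_def)
    have cases: "x \<in> ?A \<or> (\<exists>S\<in>K - C. x \<in> closed_simplex S)" if "x \<in> ?X" for x
      using that unfolding split by blast
    show "H (t, x) \<in> ?X" if t: "t \<in> {0..1}" and x: "x \<in> ?X" for t x
    proof (cases "x \<in> ?A")
      case True
      then show ?thesis
        using h(2)[OF t True] geometric_realization_mono[OF CK] by (auto simp: H_def)
    next
      case False
      then obtain S where S: "S \<in> K - C" "x \<in> closed_simplex S"
        using cases[OF x] by blast
      then show ?thesis
        using H_edge[OF S t] \<gamma>X[OF S(1) u_range[OF S t]] by simp
    qed
    show "H (0, x) = x" if x: "x \<in> ?X" for x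
    proof (cases "x \<in> ?A")
      case True
      then show ?thesis
        using h(3)[OF True] by (simp add: H_def)
    next
      case False
      then obtain S where S: "S \<in> K - C" "x \<in> closed_simplex S"
        using cases[OF x] by blast
      have "H (0, x) = \<gamma> S (x (q S))"
        using H_edge[OF S, of 0] by (simp add: u_def)
      also have "\<dots> = x"
        using \<gamma>1[OF S(1) q01[OF S]] x_eq[OF S] by simp
      finally show ?thesis .
    qed
  qed
qed

text \<open>With \<open>C\<close> in place of a spanning tree, every simplex outside
  \<open>C\<close> is an edge with both ends in \<open>C\<close>. \<open>F\<close> has one circle
  coordinate for each of these edges; it is constant on \<open>C\<close> and injective on the rest,
  which exhibits the wedge as the quotient by \<open>C\<close>.\<close>

lemma graph_complex_homotopy_eqv_wedge:
  assumes K: "abstract_complex K" "finite K" and dim: "\<And>S. S \<in> K \<Longrightarrow> card S \<le> 2"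
    and v0: "{v0} \<in> K" and conn: "\<And>v. {v} \<in> K \<Longrightarrow> (v0, v) \<in> {(x, y). {x, y} \<in> K}\<^sup>*"
  shows "\<exists>k. geometric_realization K homotopy_eqv wedge_of_circles k"
proof -
  obtain C where C: "abstract_complex C" "C \<subseteq> K" "contractible (geometric_realization C)"
    and verts: "\<And>v. {v} \<in> K \<Longrightarrow> {v} \<in> C"
    using contractible_spanning_subcomplex[OF K v0 conn] by blast
  let ?A = "geometric_realization C" and ?X = "geometric_realization K"
  have "{} \<in> C"
    using abstract_complex_subset[OF C(1) verts[OF v0]] by blast
  have card2: "card S = 2" if S: "S \<in> K - C" for S
  proof -
    have "card S \<noteq> 0"
      using S \<open>{} \<in> C\<close> abstract_complex_finite[OF K(1)] by auto
    moreover have "card S \<noteq> 1"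
      using S verts by (auto simp: card_1_singleton_iff)
    ultimately show ?thesis
      using dim[of S] S by simp
  qed
  define k where "k = card (K - C)"
  obtain e where e: "bij_betw e {0..<k} (K - C)"
    using ex_bij_betw_nat_finite[of "K - C"] K(2) by (auto simp: k_def)
  have eK: "e i \<in> K - C" if "i < k" for i
    using e that by (auto simp: bij_betw_def)
  have "\<exists>p q. e i = {p, q} \<and> p \<noteq> q" if "i < k" for i
    using card2[OF eK[OF that]] by (auto simp: card_2_iff)
  then obtain p q where pq: "\<And>i. i < k \<Longrightarrow> e i = {p i, q i}" "\<And>i. i < k \<Longrightarrow> p i \<noteq> q i"
    by metis
  have e_inj: "{p i, q i} \<noteq> {p j, q j}" if "i < k" "j < k" "i \<noteq> j" for i j
    using e that pq(1)[of i] pq(1)[of j] by (auto simp: bij_betw_def inj_on_def)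
  have split: "?X = ?A \<union> (\<Union>i<k. closed_simplex {p i, q i})"
  proof -
    have "K - C = (\<lambda>i. {p i, q i}) ` {..<k}"
      using e pq(1) by (simp add: bij_betw_def lessThan_atLeast0)
    then show ?thesis
      using geometric_realization_split[OF C(1) K(1) C(2)] by simp
  qed
  define F where "F x = (\<lambda>i. if i < k then circle_point (x (p i)) (x (q i)) else 1)"
    for x :: "'a \<Rightarrow> real"
  have F_A: "F x = (\<lambda>_. 1)" if "x \<in> ?A" for x
  proof
    fix i
    show "F x i = 1"
      using missing_edge_vanishes[OF C(1) that, of "p i" "q i"] eK[of i] pq(1)[of i]
      by (auto simp: F_def circle_point_eq_1_iff)
  qed
  have F_edge: "F x j = 1" if "x \<in> closed_simplex {p i, q i}" "i < k" "j \<noteq> i" for x i j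
    using other_edge_vanishes[OF that(1), of "p j" "q j"] e_inj[of j i] pq(2)[of j] that
    by (auto simp: F_def circle_point_eq_1_iff)
  have edge_A: "x \<in> ?A" if x: "x \<in> closed_simplex {p i, q i}" and i: "i < k" and 1: "F x i = 1" for x i
  proof -
    have "x (p i) = 0 \<or> x (q i) = 0"
      using 1 i by (simp add: F_def circle_point_eq_1_iff)
    then have "x = edge_point (p i) (p i) 0 \<or> x = edge_point (q i) (q i) 0"
      using closed_simplex_pair_endpoints[OF x pq(2)[OF i]] by blast
    moreover have "{p i, q i} \<in> K"
      using eK[OF i] pq(1)[OF i] by simp
    then have "{p i} \<in> C" "{q i} \<in> C"
      using verts abstract_complex_subset[OF K(1)] by blast+
    ultimately show ?thesis
      using vertex_in_geometric_realization[OF C(1)] by blast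
  qed
  have on_edge: "\<exists>i<k. x \<in> closed_simplex {p i, q i} \<and> F x i \<noteq> 1" if x: "x \<in> ?X" "x \<notin> ?A" for x
  proof -
    obtain i where "i < k" "x \<in> closed_simplex {p i, q i}"
      using x unfolding split by blast
    then show ?thesis
      using edge_A[of x i] x(2) by blast
  qed
  \<comment> \<open>The contraction ends in a constant map; its extension to \<open>K\<close>
    therefore moves \<open>C\<close> within itself to a point.\<close>
  obtain c where "homotopic_with (\<lambda>_. True) (top_of_set ?A) (top_of_set ?A) id (\<lambda>_. c)"
    using C(3) by (auto simp: contractible_def)
  then obtain h where h: "continuous_map (prod_topology (top_of_set {0..1::real}) (top_of_set ?A)) (top_of_set ?A) h"
    and h01: "\<And>x. h (0, x) = x" "\<And>x. h (1, x) = c"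
    by (auto simp: homotopic_with_def)
  have "continuous_on ({0..1} \<times> ?A) h"
    and hA: "\<And>t x. t \<in> {0..1} \<Longrightarrow> x \<in> ?A \<Longrightarrow> h (t, x) \<in> ?A"
    using h by (auto simp: continuous_map_in_subtopology image_subset_iff Pi_iff)
  then obtain H where H: "continuous_on ({0..1} \<times> ?X) H"
      "\<And>t x. t \<in> {0..1} \<Longrightarrow> x \<in> ?X \<Longrightarrow> H (t, x) \<in> ?X"
      "\<And>x. x \<in> ?X \<Longrightarrow> H (0, x) = x" "\<And>t x. x \<in> ?A \<Longrightarrow> H (t, x) = h (t, x)"
    using extend_homotopy_over_edges[OF C(1) K C(2) card2 verts, of h] h01(1) by blast
  have "?X homotopy_eqv wedge_of_circles k"
  proof (rule homotopy_eqv_collapse_contractible[where F = F and H = H and A = ?A])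
    show "compact ?X"
      by (rule compact_geometric_realization[OF K])
    show "continuous_on ?X F"
    proof (rule continuous_on_coordinatewise_then_product)
      fix i
      have coord: "continuous_on ?X (\<lambda>x. x v)" for v
        by (rule continuous_on_coordinate[OF continuous_on_id])
      have "continuous_on ?X (\<lambda>x. circle_point (x (p i)) (x (q i)))"
        unfolding circle_point_def Complex_eq
        by (intro continuous_intros coord)
      then show "continuous_on ?X (\<lambda>x. F x i)"
        by (cases "i < k") (auto simp: F_def)
    qed
    show "F ` ?X = wedge_of_circles k"
    proof
      show "F ` ?X \<subseteq> wedge_of_circles k"
      proof
        fix z assume "z \<in> F ` ?X"
        then obtain x where x: "x \<in> ?X" and z: "z = F x" by blast
        show "z \<in> wedge_of_circles k"
        proof (cases "x \<in> ?A")
          case True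
          then show ?thesis
            unfolding z F_A[OF True] by (simp add: wedge_of_circles_def)
        next
          case False
          then obtain i where i: "i < k" "x \<in> closed_simplex {p i, q i}"
            using on_edge[OF x] by blast
          have "norm (F x i) = 1"
            using norm_circle_point[of "x (p i)" "x (q i)"] closed_simplex_pairD[OF i(2) pq(2)[OF i(1)]] i(1)
            by (simp add: F_def)
          then have "norm (F x j) = 1" for j
            using F_edge[OF i(2,1), of j] by (cases "j = i") auto
          moreover have "j = i" if "F x j \<noteq> 1" for j
            using F_edge[OF i(2,1), of j] that by blast
          moreover have "F x j = 1" if "j \<ge> k" for j
            using that by (simp add: F_def)
          ultimately show ?thesis
            unfolding z wedge_of_circles_def by (auto; metis)
        qed
      qed
      show "wedge_of_circles k \<subseteq> F ` ?X"
      proof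
        fix z assume z: "z \<in> wedge_of_circles k"
        show "z \<in> F ` ?X"
        proof (cases "\<exists>i. z i \<noteq> 1")
          case False
          then have "z = (\<lambda>_. 1)" by auto
          then have "z = F (edge_point v0 v0 0)"
            using F_A[OF vertex_in_geometric_realization[OF C(1) verts[OF v0]]] by simp
          then show ?thesis
            using vertex_in_geometric_realization[OF K(1) v0] by blast
        next
          case True
          then obtain i where i: "z i \<noteq> 1" by blast
          then have ik: "i < k"
            using z by (auto simp: wedge_of_circles_def not_le[symmetric])
          then have "norm (z i) = 1"
            using z by (auto simp: wedge_of_circles_def)
          then obtain u where u: "0 \<le> u" "u \<le> 1" "circle_point (1 - u) u = z i"
            by (rule circle_point_surj)
          let ?x = "edge_point (p i) (q i) u"
          have x: "?x \<in> closed_simplex {p i, q i}"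
            by (rule edge_point_in_closed_simplex[OF pq(2)[OF ik] u(1,2)])
          have "F ?x i = z i"
            using ik pq(2)[OF ik] u(3) by (simp add: F_def edge_point_def)
          moreover have "F ?x j = z j" if "j \<noteq> i" for j
            using F_edge[OF x ik that] z i that by (auto simp: wedge_of_circles_def)
          ultimately have "F ?x = z" by (metis ext)
          then show ?thesis
            using x ik unfolding split by blast
        qed
      qed
    qed
    show "x = y \<or> x \<in> ?A \<and> y \<in> ?A" if x: "x \<in> ?X" and y: "y \<in> ?X" and eq: "F x = F y" for x y
    proof (cases "x \<in> ?A \<or> y \<in> ?A")
      case True
      then have "F x = (\<lambda>_. 1)" "F y = (\<lambda>_. 1)"
        using F_A eq by auto
      then show ?thesis
        using on_edge[OF x] on_edge[OF y] by auto
    next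
      case False
      then obtain i j where i: "i < k" "x \<in> closed_simplex {p i, q i}" "F x i \<noteq> 1"
        and j: "j < k" "y \<in> closed_simplex {p j, q j}" "F y j \<noteq> 1"
        using on_edge[OF x] on_edge[OF y] by blast
      have "i = j"
        using F_edge[OF j(2,1), of i] i(3) eq by auto
      note x' = closed_simplex_pairD[OF i(2) pq(2)[OF i(1)]]
      note y' = closed_simplex_pairD[OF j(2) pq(2)[OF j(1)], folded \<open>i = j\<close>]
      have "x (q i) = y (q i)"
      proof (rule circle_point_inj)
        show "circle_point (x (p i)) (x (q i)) = circle_point (y (p i)) (y (q i))"
          using fun_cong[OF eq, of i] i(1) by (simp add: F_def)
        show "circle_point (x (p i)) (x (q i)) \<noteq> 1"
          using i(1,3) by (simp add: F_def)
      qed (use x'(4) y'(4) in auto)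
      then show ?thesis
        using x'(1) y'(1) by metis
    qed
    show "F x = F y" if "x \<in> ?A" "y \<in> ?A" for x y
      using F_A that by simp
    show "continuous_on ({0..1} \<times> ?X) H"
      by (rule H)
    show "H ` ({0..1} \<times> ?X) \<subseteq> ?X"
      using H(2) by auto
    show "H (0, x) = x" if "x \<in> ?X" for x
      by (rule H(3)[OF that])
    show "H (t, x) \<in> ?A" if "t \<in> {0..1}" "x \<in> ?A" for t x
      using H(4)[OF that(2), of t] hA[OF that] by simp
    show "H (1, x) = H (1, y)" if "x \<in> ?A" "y \<in> ?A" for x y
      using H(4) h01(2) that by simp
  qed
  then show ?thesis by blast
qed

section \<open>Line graphs of wheel-free graphs\<close>

text \<open>The clique complex of the line graph in terms of the edge set alone, so that edges can
  be removed without reference to a graph. For distinct two-element edges, to meet is to share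
  exactly one endpoint.\<close>

definition line_complex :: "'a set set \<Rightarrow> 'a set set set" where
  "line_complex E = {S. finite S \<and> S \<subseteq> E \<and> (\<forall>e\<in>S. \<forall>f\<in>S. e \<inter> f \<noteq> {})}"

lemma abstract_complex_line_complex: "abstract_complex (line_complex E)"
  unfolding abstract_complex_def line_complex_def by (blast intro: finite_subset)

lemma card_2_inter_eq_1_iff:
  assumes "card e = 2" "card f = 2" "e \<noteq> f"
  shows "card (e \<inter> f) = 1 \<longleftrightarrow> e \<inter> f \<noteq> {}"
proof -
  have fin: "finite e" "finite f"
    using assms(1,2) card.infinite by fastforce+
  have "e \<inter> f \<noteq> e"
    using assms fin card_subset_eq[of f e] by auto
  then have "card (e \<inter> f) < 2"
    using psubset_card_mono[OF fin(1), of "e \<inter> f"] assms(1) by auto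
  moreover have "card (e \<inter> f) = 0 \<longleftrightarrow> e \<inter> f = {}"
    using fin by simp
  ultimately show ?thesis
    by auto
qed

lemma simple_graph_card:
  assumes "simple_graph G" "e \<in> edges G"
  shows "card e = 2" "e \<subseteq> verts G"
  using assms by (auto simp: simple_graph_def nsets_def)

lemma clique_complex_line_graph:
  assumes G: "simple_graph G"
  shows "clique_complex (line_graph G) = line_complex (edges G)"
proof -
  have adj: "(e \<noteq> f \<longrightarrow> {e, f} \<in> edges (line_graph G)) \<longleftrightarrow> e \<inter> f \<noteq> {}"
    if ef: "e \<in> edges G" "f \<in> edges G" for e f
  proof (cases "e = f")
    case True
    then show ?thesis
      using simple_graph_card(1)[OF G ef(1)] by auto
  next
    case False
    have "{e, f} \<in> edges (line_graph G) \<longleftrightarrow> card (e \<inter> f) = 1"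
      using ef by (auto simp: line_graph_def doubleton_eq_iff Int_commute)
    then show ?thesis
      using card_2_inter_eq_1_iff[of e f] simple_graph_card(1)[OF G] ef False by simp
  qed
  have "verts (line_graph G) = edges G"
    by (simp add: line_graph_def)
  then show ?thesis
    unfolding clique_complex_def line_complex_def
    by (intro Collect_cong conj_cong ball_cong refl) (auto simp: adj subset_iff)
qed

section \<open>Wheels and edges lying in one triangle\<close>

text \<open>The hub \<open>a\<close> and the rim \<open>x\<close> label the standard wheel by
  vertices of \<open>G\<close>. Since the labelling is injective, its image is a subgraph with the
  inverse labelling as isomorphism.\<close>

lemma wheel_in_graph:
  assumes G: "simple_graph G" and n: "3 \<le> n" and inj: "inj_on x {..<n}" and a: "a \<notin> x ` {..<n}"
    and spokes: "\<And>i. i < n \<Longrightarrow> {a, x i} \<in> edges G"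
    and rim: "\<And>i. i < n \<Longrightarrow> {x i, x (Suc i mod n)} \<in> edges G"
  shows "\<not> wheel_free G"
proof -
  define g where "g z = (case z of None \<Rightarrow> a | Some i \<Rightarrow> x i)" for z
  let ?W = "wheel_graph n"
  have vW: "verts ?W = insert None (Some ` {..<n})"
    by (simp add: wheel_graph_def cone_graph_def cycle_graph_def)
  have eW: "edges ?W = (\<lambda>i. {Some i, Some (Suc i mod n)}) ` {..<n} \<union> (\<lambda>i. {None, Some i}) ` {..<n}"
    by (auto simp: wheel_graph_def cone_graph_def cycle_graph_def image_def)
  have g_inj: "inj_on g (verts ?W)"
    using inj a unfolding vW by (auto simp: inj_on_def g_def)
  have e_sub: "e \<subseteq> verts ?W" if "e \<in> edges ?W" for e
    using that n unfolding vW eW by auto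
  have g_edge: "g ` e \<in> edges G" if "e \<in> edges ?W" for e
    using that spokes rim unfolding eW by (auto simp: g_def)
  define H where "H = (g ` verts ?W, (\<lambda>e. g ` e) ` edges ?W)"
  \<comment> \<open>Every vertex of the wheel lies on a spoke, the hub on the one to rim vertex 0,
    so its label is an end of an edge of \<open>G\<close>.\<close>
  have "{None, Some (case z of None \<Rightarrow> 0 | Some i \<Rightarrow> i)} \<in> edges ?W" if "z \<in> verts ?W" for z
    using that n unfolding vW eW by (auto split: option.split)
  moreover have "z \<in> {None, Some (case z of None \<Rightarrow> 0 | Some i \<Rightarrow> i)}" for z :: "nat option"
    by (cases z) auto
  ultimately have "g z \<in> verts G" if "z \<in> verts ?W" for z
    using that g_edge simple_graph_card(2)[OF G] by blast
  moreover have "simple_graph H"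
    unfolding simple_graph_def
  proof
    fix d assume "d \<in> edges H"
    then obtain e where e: "e \<in> edges ?W" "d = g ` e"
      by (auto simp: H_def)
    then have "card d = 2" "d \<subseteq> verts H"
      using simple_graph_card(1)[OF G g_edge] e_sub by (auto simp: H_def)
    moreover from \<open>card d = 2\<close> have "finite d"
      using card.infinite by fastforce
    ultimately show "d \<in> nsets (verts H) 2"
      by (simp add: nsets_def)
  qed
  ultimately have "subgraph H G"
    using g_edge by (auto simp: subgraph_def H_def)
  moreover have "isomorphic_graphs H ?W"
    unfolding isomorphic_graphs_def
  proof (intro exI[of _ "inv_into (verts ?W) g"] conjI)
    show "bij_betw (inv_into (verts ?W) g) (verts H) (verts ?W)"
      using g_inj by (simp add: H_def bij_betw_inv_into inj_on_imp_bij_betw)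
    have "inv_into (verts ?W) g ` g ` e = e" if "e \<in> edges ?W" for e
      by (rule inv_into_image_cancel[OF g_inj e_sub[OF that]])
    then show "edges ?W = (\<lambda>e. inv_into (verts ?W) g ` e) ` edges H"
      by (simp add: H_def image_image)
  qed
  ultimately show ?thesis
    using n unfolding wheel_free_def by blast
qed

text \<open>The neighbourhood of a vertex \<open>a\<close> of a wheel-free graph is a forest, and the end of a longest
  path in it is a leaf \<open>b\<close>.\<close>

lemma wheel_free_edge_in_one_triangle:
  assumes G: "simple_graph G" "finite (verts G)" "wheel_free G"
    and tri: "{a, y} \<in> edges G" "{a, z} \<in> edges G" "{y, z} \<in> edges G"
  obtains b c where "{a, b} \<in> edges G" "{a, c} \<in> edges G" "{b, c} \<in> edges G"
    "\<And>x. {a, x} \<in> edges G \<Longrightarrow> {b, x} \<in> edges G \<Longrightarrow> x = c"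
proof -
  define P where "P xs \<longleftrightarrow> distinct xs \<and> 2 \<le> length xs \<and> (\<forall>x\<in>set xs. {a, x} \<in> edges G) \<and>
    (\<forall>i. Suc i < length xs \<longrightarrow> {xs ! i, xs ! Suc i} \<in> edges G)" for xs
  have ne: "u \<noteq> v" if "{u, v} \<in> edges G" for u v
    using simple_graph_card(1)[OF G(1) that] by auto
  \<comment> \<open>The triangle provides a path with two vertices; demanding at least two in
    \<open>P\<close> guarantees that \<open>xs ! 1\<close>, the later \<open>c\<close>,
    exists.\<close>
  have "P [y, z]"
    using tri ne[OF tri(3)] unfolding P_def by simp
  moreover have "\<forall>xs. P xs \<longrightarrow> length xs < Suc (card (verts G))"
  proof (intro allI impI)
    fix xs assume "P xs"
    then have "set xs \<subseteq> verts G" "distinct xs"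
      using simple_graph_card(2)[OF G(1)] by (auto simp: P_def)
    then show "length xs < Suc (card (verts G))"
      using card_mono[OF G(2), of "set xs"] distinct_card[of xs] by simp
  qed
  ultimately obtain xs where xs: "P xs" and max: "\<And>ys. P ys \<Longrightarrow> length ys \<le> length xs"
    using ex_has_greatest_nat[of P "[y, z]" length "Suc (card (verts G))"] by blast
  show ?thesis
  proof (rule that[of "xs ! 0" "xs ! 1"])
    have len: "0 < length xs" "1 < length xs"
      using xs by (auto simp: P_def)
    show b: "{a, xs ! 0} \<in> edges G" and "{a, xs ! 1} \<in> edges G"
      using xs len by (auto simp: P_def)
    show "{xs ! 0, xs ! 1} \<in> edges G"
      using xs len by (auto simp: P_def)
    \<comment> \<open>Another neighbour \<open>x\<close> of the end would lengthen the path or, as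
      \<open>xs ! j\<close> with \<open>j \<ge> 2\<close>, close its first \<open>Suc j\<close>
      vertices to the rim of a wheel with hub \<open>a\<close>.\<close>
    show "x = xs ! 1" if x: "{a, x} \<in> edges G" "{xs ! 0, x} \<in> edges G" for x
    proof (cases "x \<in> set xs")
      case False
      have "{(x # xs) ! i, (x # xs) ! Suc i} \<in> edges G" if "Suc i < length (x # xs)" for i
      proof (cases i)
        case 0
        then show ?thesis
          using x(2) by (simp add: doubleton_eq_iff insert_commute)
      next
        case (Suc m)
        then show ?thesis
          using xs that unfolding P_def by simp
      qed
      then have "P (x # xs)"
        using xs x(1) False unfolding P_def by simp
      then show ?thesis
        using max[of "x # xs"] by simp
    next
      case True
      then obtain j where j: "j < length xs" "x = xs ! j"
        by (auto simp: in_set_conv_nth)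
      show ?thesis
      proof (rule ccontr)
        assume "x \<noteq> xs ! 1"
        then have "j \<noteq> 1"
          using j by auto
        moreover have "j \<noteq> 0"
          using j ne[OF x(2)] by metis
        ultimately have n: "3 \<le> Suc j" by simp
        have "\<not> wheel_free G"
        proof (rule wheel_in_graph[OF G(1) n])
          show "inj_on ((!) xs) {..<Suc j}"
            using xs j by (auto simp: P_def inj_on_def nth_eq_iff_index_eq)
          show "{a, xs ! i} \<in> edges G" if "i < Suc j" for i
            using xs j that by (auto simp: P_def)
          then show "a \<notin> (!) xs ` {..<Suc j}"
            using ne by blast
          show "{xs ! i, xs ! (Suc i mod Suc j)} \<in> edges G" if "i < Suc j" for i
          proof (cases "i = j")
            case True
            then show ?thesis
              using x(2) j(2) by (metis insert_commute mod_self)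
          next
            case False
            then show ?thesis
              using xs j(1) that unfolding P_def by simp
          qed
        qed
        then show False
          using G(3) by simp
      qed
    qed
  qed
qed

text \<open>A simplex containing \<open>{a, b}\<close> and an edge \<open>f\<close> at
  \<open>a\<close> off the triangle has all its edges at \<open>a\<close>, so \<open>{a, c}\<close>
  is an apex for \<open>{{a, b}, f}\<close>; at \<open>b\<close> the apex is \<open>{b, c}\<close>.
  Once these faces are gone, the link of \<open>{a, b}\<close> is the segment from
  \<open>{a, c}\<close> to \<open>{b, c}\<close>, a cone, and the vertex \<open>{a, b}\<close>
  itself can be removed.\<close>

lemma line_complex_remove_edge:
  assumes E: "finite E" "\<And>e. e \<in> E \<Longrightarrow> card e = 2"
    and abc: "{a, b} \<in> E" "{a, c} \<in> E" "{b, c} \<in> E"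
    and unique: "\<And>x. {a, x} \<in> E \<Longrightarrow> {b, x} \<in> E \<Longrightarrow> x = c"
  shows "geometric_realization (line_complex E) homotopy_eqv
    geometric_realization (line_complex (E - {{a, b}}))"
proof -
  have ne: "a \<noteq> b" "a \<noteq> c" "b \<noteq> c"
    using abc E(2) by fastforce+
  have at: "\<exists>x. e = {v, x} \<and> v \<noteq> x" if "e \<in> E" "v \<in> e" for e v
    using E(2)[OF that(1)] that(2) by (auto simp: card_2_iff)
  define A1 where "A1 = {{{a, b}, f} | f. f \<in> E \<and> a \<in> f \<and> f \<noteq> {a, b} \<and> f \<noteq> {a, c}}"
  define A2 where "A2 = {{{a, b}, f} | f. f \<in> E \<and> b \<in> f \<and> f \<noteq> {a, b} \<and> f \<noteq> {b, c}}"
  define w where "w \<tau> = (if \<tau> \<in> A1 then {a, c} else {b, c})" for \<tau>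
  let ?K = "line_complex E"
  let ?K' = "{S \<in> ?K. \<forall>\<tau>\<in>A1 \<union> A2. \<not> \<tau> \<subseteq> S}"
  have star: "insert {v, c} S \<in> ?K"
    if S: "S \<in> ?K" and v: "{v, c} \<in> E" "\<And>g. g \<in> S \<Longrightarrow> v \<in> g" for S v
    using assms(1) that unfolding line_complex_def by blast
  \<comment> \<open>An edge \<open>g\<close> that meets \<open>{v, v'}\<close> and
    \<open>f = {v, x}\<close> but avoids \<open>v\<close> must be \<open>{v', x}\<close>. Then
    \<open>x\<close> completes a triangle on \<open>{a, b}\<close>, so \<open>x = c\<close>, against
    the choice of \<open>f\<close>. The variables \<open>v\<close> and \<open>v'\<close> cover both
    orders of \<open>a\<close> and \<open>b\<close>.\<close>
  have common: "v \<in> g"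
    if S: "S \<in> ?K" "{a, b} \<in> S" "f \<in> S" "g \<in> S" and v: "{v, v'} = {a, b}" "v \<in> f" "f \<noteq> {a, b}" "f \<noteq> {v, c}"
    for S v v' f g
  proof (rule ccontr)
    assume "v \<notin> g"
    have "f \<in> E" "g \<in> E" "g \<inter> {v, v'} \<noteq> {}" "g \<inter> f \<noteq> {}"
      using S unfolding v(1) line_complex_def by blast+
    then have "v' \<in> g"
      using \<open>v \<notin> g\<close> by blast
    obtain x where x: "f = {v, x}"
      using at[OF \<open>f \<in> E\<close> v(2)] by blast
    then have "x \<in> g"
      using \<open>g \<inter> f \<noteq> {}\<close> \<open>v \<notin> g\<close> by blast
    have "x \<noteq> v'"
      using x v(1,3) by blast
    then have "g = {v', x}"
      using at[OF \<open>g \<in> E\<close> \<open>v' \<in> g\<close>] \<open>x \<in> g\<close> by blast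
    then have "{a, x} \<in> E" "{b, x} \<in> E"
      using x \<open>f \<in> E\<close> \<open>g \<in> E\<close> v(1) by (auto simp: doubleton_eq_iff)
    then show False
      using unique x v(4) by blast
  qed
  have h1: "geometric_realization ?K homotopy_eqv geometric_realization ?K'"
  proof (rule geometric_realization_collapse_family[OF abstract_complex_line_complex, where w = w])
    have "A1 \<union> A2 \<subseteq> (\<lambda>f. {{a, b}, f}) ` E"
      by (auto simp: A1_def A2_def)
    then show "finite (A1 \<union> A2)"
      using E(1) finite_surj by blast
    \<comment> \<open>Neither apex lies in a face to be removed: each is excluded explicitly at the
      end of \<open>{a, b}\<close> that it contains and misses the other end.\<close>
    have in_A: "g = {a, b} \<or> a \<in> g \<and> g \<noteq> {a, c} \<or> b \<in> g \<and> g \<noteq> {b, c}" if "g \<in> \<Union>(A1 \<union> A2)" for g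
      using that unfolding A1_def A2_def by blast
    have "{a, c} \<noteq> {a, b}" "{b, c} \<noteq> {a, b}" "b \<notin> {a, c}" "a \<notin> {b, c}"
      using ne by (auto simp: doubleton_eq_iff)
    then have "{a, c} \<notin> \<Union>(A1 \<union> A2)" "{b, c} \<notin> \<Union>(A1 \<union> A2)"
      using in_A by blast+
    then have "w \<tau> \<notin> \<Union>(A1 \<union> A2)" for \<tau>
      unfolding w_def by simp
    moreover have "finite \<tau> \<and> \<tau> \<noteq> {}" if "\<tau> \<in> A1 \<union> A2" for \<tau>
      using that by (auto simp: A1_def A2_def)
    ultimately show "finite \<tau> \<and> \<tau> \<noteq> {} \<and> w \<tau> \<notin> \<Union>(A1 \<union> A2)" if "\<tau> \<in> A1 \<union> A2" for \<tau>
      using that by blast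
    show "insert (w \<tau>) S \<in> ?K" if S: "S \<in> ?K" and \<tau>: "\<tau> \<in> A1 \<union> A2" "\<tau> \<subseteq> S" for S \<tau>
    proof (cases "\<tau> \<in> A1")
      case True
      then obtain f where f: "\<tau> = {{a, b}, f}" "a \<in> f" "f \<noteq> {a, b}" "f \<noteq> {a, c}"
        by (auto simp: A1_def)
      then have "a \<in> g" if "g \<in> S" for g
        using common[OF S, of f g a b] \<tau>(2) that by auto
      then show ?thesis
        using star[OF S abc(2)] True by (simp add: w_def)
    next
      case False
      then obtain f where f: "\<tau> = {{a, b}, f}" "b \<in> f" "f \<noteq> {a, b}" "f \<noteq> {b, c}"
        using \<tau>(1) by (auto simp: A2_def)
      then have "b \<in> g" if "g \<in> S" for g
        using common[OF S, of f g b a] \<tau>(2) that by auto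
      then show ?thesis
        using star[OF S abc(3)] False by (simp add: w_def)
    qed
  qed
  have h2: "geometric_realization ?K' homotopy_eqv
      geometric_realization {S \<in> ?K'. \<not> {{a, b}} \<subseteq> S}"
  proof (rule geometric_realization_collapse[where w = "{a, c}"])
    show "abstract_complex ?K'"
      by (rule abstract_complex_avoiding[OF abstract_complex_line_complex])
    show "{a, c} \<notin> {{a, b}}"
      using ne by (auto simp: doubleton_eq_iff)
    show "insert {a, c} S \<in> ?K'" if S: "S \<in> ?K'" "{{a, b}} \<subseteq> S" for S
    proof -
      have SK: "S \<in> ?K" and avoid: "\<And>\<tau>. \<tau> \<in> A1 \<union> A2 \<Longrightarrow> \<not> \<tau> \<subseteq> S"
        using S(1) by auto
      have sub: "S \<subseteq> {{a, b}, {a, c}, {b, c}}"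
      proof
        fix g assume g: "g \<in> S"
        then have "g \<in> E" "g \<inter> {a, b} \<noteq> {}"
          using SK S(2) by (auto simp: line_complex_def)
        moreover have "{{a, b}, g} \<subseteq> S"
          using g S(2) by blast
        then have "{{a, b}, g} \<notin> A1" "{{a, b}, g} \<notin> A2"
          using avoid by blast+
        ultimately show "g \<in> {{a, b}, {a, c}, {b, c}}"
          unfolding A1_def A2_def by blast
      qed
      have "\<not> \<tau> \<subseteq> {{a, b}, {a, c}, {b, c}}" if "\<tau> \<in> A1 \<union> A2" for \<tau>
        using that ne unfolding A1_def A2_def by blast
      moreover have sub': "insert {a, c} S \<subseteq> {{a, b}, {a, c}, {b, c}}"
        using sub by simp
      moreover have "{{a, b}, {a, c}, {b, c}} \<in> ?K"
        using abc by (auto simp: line_complex_def)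
      then have "insert {a, c} S \<in> ?K"
        using abstract_complex_subset[OF abstract_complex_line_complex _ sub'] by blast
      ultimately show ?thesis
        by blast
    qed
  qed auto
  have eq: "{S \<in> ?K'. \<not> {{a, b}} \<subseteq> S} = line_complex (E - {{a, b}})"
    unfolding line_complex_def A1_def A2_def by blast
  show ?thesis
    using homotopy_eqv_trans[OF h1 h2] unfolding eq .
qed

section \<open>Triangle-free graphs\<close>

text \<open>Pairwise meeting edges have a common vertex or form a triangle: if one edge misses the
  end \<open>a\<close> of \<open>{a, b}\<close> and another misses \<open>b\<close>, they are
  \<open>{b, c}\<close> and \<open>{a, d}\<close>, and they meet only for
  \<open>c = d\<close>.\<close>

lemma triangle_free_intersecting_family:
  assumes E: "\<And>e. e \<in> E \<Longrightarrow> card e = 2"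
    and free: "\<nexists>a b c. {a, b} \<in> E \<and> {a, c} \<in> E \<and> {b, c} \<in> E"
    and S: "S \<in> line_complex E" "S \<noteq> {}"
  shows "\<exists>v. \<forall>e\<in>S. v \<in> e"
proof -
  have SE: "S \<subseteq> E" and meet: "\<And>e f. e \<in> S \<Longrightarrow> f \<in> S \<Longrightarrow> e \<inter> f \<noteq> {}"
    using S(1) by (auto simp: line_complex_def)
  have at: "\<exists>x. e = {v, x}" if "e \<in> S" "v \<in> e" for e v
    using E[of e] SE that by (auto simp: card_2_iff)
  obtain e where e: "e \<in> S"
    using S(2) by blast
  then obtain a b where ab: "e = {a, b}"
    using E[of e] SE by (auto simp: card_2_iff)
  show ?thesis
  proof (rule ccontr)
    assume "\<not> ?thesis"
    then obtain g g' where g: "g \<in> S" "a \<notin> g" and g': "g' \<in> S" "b \<notin> g'"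
      by blast
    have "b \<in> g" "a \<in> g'"
      using meet[OF e g(1)] meet[OF e g'(1)] g g' ab by auto
    then obtain c d where c: "g = {b, c}" and d: "g' = {a, d}"
      using at g(1) g'(1) by metis
    have "d = c"
      using meet[OF g(1) g'(1)] g(2) g'(2) c d by auto
    then show False
      using free e g(1) g'(1) SE ab c d by auto
  qed
qed

text \<open>The union \<open>M\<close> of the simplices \<open>cone v\<close> is collapsed in two
  ways. Every simplex containing \<open>{v}\<close> lies in \<open>cone v\<close>, so the cone
  points can be removed; by triangle-freeness what remains is the whole line complex. Two distinct
  edges meeting in \<open>v\<close> lie together in no other cone, so all such pairs can be removed;
  what remains is \<open>B\<close>, whose one-dimensional simplices are the incidences of a vertex
  with an edge.\<close>

lemma triangle_free_line_complex_homotopy_eqv_wedge: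
  assumes E: "finite E" "E \<noteq> {}" "\<And>e. e \<in> E \<Longrightarrow> card e = 2"
    and free: "\<nexists>a b c. {a, b} \<in> E \<and> {a, c} \<in> E \<and> {b, c} \<in> E"
    and conn: "\<And>u v. u \<in> \<Union>E \<Longrightarrow> v \<in> \<Union>E \<Longrightarrow> (u, v) \<in> {(x, y). {x, y} \<in> E}\<^sup>*"
  shows "\<exists>k. geometric_realization (line_complex E) homotopy_eqv wedge_of_circles k"
proof -
  \<comment> \<open>The apex over the star of \<open>v\<close> is the singleton \<open>{v}\<close>, which is never an edge.\<close>
  define cone where "cone v = insert {v} {e \<in> E. v \<in> e}" for v
  define M where "M = (\<Union>v\<in>\<Union>E. Pow (cone v))"
  have single: "{v} \<notin> E" for v
    using E(3)[of "{v}"] by auto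
  have fin_cone: "finite (cone v)" for v
    using E(1) by (simp add: cone_def)
  have fin_V: "finite (\<Union>E)"
    using E(1,3) by (metis card.infinite finite_Union zero_neq_numeral)
  have M: "abstract_complex M"
    using fin_cone unfolding M_def abstract_complex_def by (blast intro: finite_subset)
  have fin_M: "finite M"
    unfolding M_def using fin_cone by (intro finite_UN_I[OF fin_V]) simp
  have MI: "S \<in> M" if "v \<in> \<Union>E" "S \<subseteq> cone v" for S v
    using that by (auto simp: M_def)
  have ME: "\<exists>v\<in>\<Union>E. S \<subseteq> cone v" if "S \<in> M" for S
    using that by (auto simp: M_def)

  have "\<exists>e. e \<in> E \<and> v \<in> e" if "v \<in> \<Union>E" for v
    using that by blast
  then obtain \<epsilon> where \<epsilon>: "\<And>v. v \<in> \<Union>E \<Longrightarrow> \<epsilon> v \<in> E \<and> v \<in> \<epsilon> v"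
    by metis
  let ?A = "(\<lambda>v. {{v}}) ` \<Union>E"
  \<comment> \<open>Any edge at \<open>v\<close> is an apex for the cone point. The nested
    \<open>the_elem\<close> recovers \<open>v\<close> from the face \<open>{{v}}\<close>.\<close>
  have M_collapse: "geometric_realization M homotopy_eqv
      geometric_realization {S \<in> M. \<forall>\<tau>\<in>?A. \<not> \<tau> \<subseteq> S}"
  proof (rule geometric_realization_collapse_family[OF M, where w = "\<lambda>\<tau>. \<epsilon> (the_elem (the_elem \<tau>))"])
    show "finite ?A"
      using fin_V by simp
    show "finite \<tau> \<and> \<tau> \<noteq> {} \<and> \<epsilon> (the_elem (the_elem \<tau>)) \<notin> \<Union>?A" if "\<tau> \<in> ?A" for \<tau>
    proof -
      obtain v where v: "v \<in> \<Union>E" "\<tau> = {{v}}"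
        using \<open>\<tau> \<in> ?A\<close> by blast
      then show ?thesis
        using \<epsilon>[OF v(1)] single by fastforce
    qed
    show "insert (\<epsilon> (the_elem (the_elem \<tau>))) S \<in> M"
      if S: "S \<in> M" and \<tau>: "\<tau> \<in> ?A" "\<tau> \<subseteq> S" for S \<tau>
    proof -
      obtain v where v: "v \<in> \<Union>E" "\<tau> = {{v}}"
        using \<tau>(1) by blast
      obtain u where u: "u \<in> \<Union>E" "S \<subseteq> cone u"
        using ME[OF S] by blast
      have "{v} \<in> cone u"
        using v(2) \<tau>(2) u(2) by blast
      then have "u = v"
        using single by (auto simp: cone_def)
      then have "insert (\<epsilon> v) S \<subseteq> cone v"
        using u(2) \<epsilon>[OF v(1)] by (simp add: cone_def)
      then show ?thesis
        using MI[OF v(1)] v(2) by simp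
    qed
  qed
  have no_singletons: "{S \<in> M. \<forall>\<tau>\<in>?A. \<not> \<tau> \<subseteq> S} = line_complex E"
  proof
    show "{S \<in> M. \<forall>\<tau>\<in>?A. \<not> \<tau> \<subseteq> S} \<subseteq> line_complex E"
    proof
      fix S assume "S \<in> {S \<in> M. \<forall>\<tau>\<in>?A. \<not> \<tau> \<subseteq> S}"
      then have S: "S \<in> M" "\<forall>\<tau>\<in>?A. \<not> \<tau> \<subseteq> S"
        by simp_all
      obtain v where v: "v \<in> \<Union>E" "S \<subseteq> cone v"
        using ME[OF S(1)] by blast
      have "{v} \<notin> S"
        using bspec[OF S(2) imageI[OF v(1)]] by simp
      then have "S \<subseteq> {e \<in> E. v \<in> e}"
        using v(2) unfolding cone_def by blast
      then show "S \<in> line_complex E"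
        using finite_subset[of S E] E(1) unfolding line_complex_def by blast
    qed
    show "line_complex E \<subseteq> {S \<in> M. \<forall>\<tau>\<in>?A. \<not> \<tau> \<subseteq> S}"
    proof
      fix S assume S: "S \<in> line_complex E"
      then have SE: "S \<subseteq> E"
        by (simp add: line_complex_def)
      have "S \<in> M"
      proof (cases "S = {}")
        case True
        obtain e v where "e \<in> E" "v \<in> e"
          using E(2,3) by fastforce
        then show ?thesis
          using True MI[of v S] by blast
      next
        case False
        obtain v where v: "\<forall>e\<in>S. v \<in> e"
          using triangle_free_intersecting_family[OF E(3) free S False] by blast
        then have "v \<in> \<Union>E" "S \<subseteq> cone v"
          using False SE by (auto simp: cone_def)
        then show ?thesis
          by (rule MI)
      qed
      moreover have "\<not> {{v}} \<subseteq> S" for v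
        using SE single by blast
      ultimately show "S \<in> {S \<in> M. \<forall>\<tau>\<in>?A. \<not> \<tau> \<subseteq> S}"
        by blast
    qed
  qed
  have LM: "geometric_realization (line_complex E) homotopy_eqv geometric_realization M"
    using M_collapse unfolding no_singletons by (subst homotopy_equivalent_space_sym)

  define P where "P = {{e, f} | e f. e \<in> E \<and> f \<in> E \<and> e \<noteq> f \<and> e \<inter> f \<noteq> {}}"
  have P_iff: "\<tau> \<in> P \<longleftrightarrow> (\<exists>e f. \<tau> = {e, f} \<and> e \<in> E \<and> f \<in> E \<and> e \<noteq> f \<and> e \<inter> f \<noteq> {})" for \<tau>
    by (simp add: P_def)
  have P_sub: "P \<subseteq> Pow E"
    by (auto simp: P_def)
  define B where "B = {S \<in> M. \<forall>\<tau>\<in>P. \<not> \<tau> \<subseteq> S}"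
  have inter: "e \<inter> f = {v}" if "e \<in> E" "f \<in> E" "e \<noteq> f" "v \<in> e" "v \<in> f" for e f v
  proof -
    have "card (e \<inter> f) = 1"
      using card_2_inter_eq_1_iff[of e f] E(3) that by blast
    then obtain u where "e \<inter> f = {u}"
      by (rule card_1_singletonE)
    then show ?thesis
      using that(4,5) by (metis IntI singletonD)
  qed
  \<comment> \<open>The apex for a pair of meeting edges is their intersection: it is a singleton
    \<open>{v}\<close>, hence a cone point and not an edge.\<close>
  have MB: "geometric_realization M homotopy_eqv geometric_realization B"
    unfolding B_def
  proof (rule geometric_realization_collapse_family[OF M, where w = Inter])
    show "finite P"
      using P_sub E(1) by (simp add: finite_subset)
    show "finite \<tau> \<and> \<tau> \<noteq> {} \<and> \<Inter>\<tau> \<notin> \<Union>P" if "\<tau> \<in> P" for \<tau>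
    proof -
      obtain e f where ef: "\<tau> = {e, f}" "e \<in> E" "f \<in> E" "e \<noteq> f" "e \<inter> f \<noteq> {}"
        using \<open>\<tau> \<in> P\<close> unfolding P_iff by blast
      then obtain v where "v \<in> e" "v \<in> f" by blast
      then have "\<Inter>\<tau> = {v}"
        using inter ef by simp
      moreover have "\<Union>P \<subseteq> E"
        using P_sub by blast
      ultimately show ?thesis
        using ef(1) single by auto
    qed
    show "insert (\<Inter>\<tau>) S \<in> M" if S: "S \<in> M" and \<tau>: "\<tau> \<in> P" "\<tau> \<subseteq> S" for S \<tau>
    proof -
      obtain e f where ef: "\<tau> = {e, f}" "e \<in> E" "f \<in> E" "e \<noteq> f"
        using \<tau>(1) unfolding P_iff by blast
      obtain v where v: "v \<in> \<Union>E" "S \<subseteq> cone v"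
        using ME[OF S] by blast
      have "v \<in> e" "v \<in> f"
        using ef \<tau>(2) v(2) single by (auto simp: cone_def)
      then have "\<Inter>\<tau> = {v}"
        using inter ef by simp
      then show ?thesis
        using MI[OF v(1)] v(2) by (simp add: cone_def)
    qed
  qed
  have B: "abstract_complex B"
    unfolding B_def by (rule abstract_complex_avoiding[OF M])
  have flag: "{{v}, e} \<in> B" if "e \<in> E" "v \<in> e" for e v
  proof -
    have "{{v}, e} \<in> M"
      by (rule MI[of v]) (use that in \<open>auto simp: cone_def\<close>)
    moreover have "\<not> {f, g} \<subseteq> {{v}, e}" if "f \<in> E" "g \<in> E" "f \<noteq> g" for f g
      using that single by blast
    then have "\<not> \<tau> \<subseteq> {{v}, e}" if "\<tau> \<in> P" for \<tau>
      using that unfolding P_iff by metis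
    ultimately show ?thesis
      by (simp add: B_def)
  qed
  obtain e0 u0 where u0: "e0 \<in> E" "u0 \<in> e0"
    using E(2,3) by fastforce
  let ?R = "{(x, y). {x, y} \<in> B}"
  \<comment> \<open>A step along an edge of \<open>E\<close> becomes two steps in \<open>B\<close>,
    with the edge itself as midpoint.\<close>
  have reach: "({u0}, {u}) \<in> ?R\<^sup>*" if "(u0, u) \<in> {(x, y). {x, y} \<in> E}\<^sup>*" for u
    using that
  proof (induction rule: rtrancl_induct)
    case base
    then show ?case by simp
  next
    case (step x y)
    then have xy: "{x, y} \<in> E" by simp
    have "({x}, {x, y}) \<in> ?R" "({x, y}, {y}) \<in> ?R"
      using flag[OF xy, of x] flag[OF xy, of y] by (auto simp: insert_commute)
    then show ?case
      using step.IH by (meson rtrancl.rtrancl_into_rtrancl)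
  qed
  have "\<exists>k. geometric_realization B homotopy_eqv wedge_of_circles k"
  proof (rule graph_complex_homotopy_eqv_wedge[OF B, where ?v0.0 = "{u0}"])
    show "finite B"
      using fin_M by (simp add: B_def)
    show "card S \<le> 2" if "S \<in> B" for S
    proof -
      have S: "S \<in> M" "\<And>\<tau>. \<tau> \<in> P \<Longrightarrow> \<not> \<tau> \<subseteq> S"
        using that by (auto simp: B_def)
      obtain v where v: "v \<in> \<Union>E" "S \<subseteq> cone v"
        using ME[OF S(1)] by blast
      \<comment> \<open>Two different edges in \<open>cone v\<close> meet in \<open>v\<close> and
        form a removed pair, so at most one edge remains beside the cone point.\<close>
      have eq: "e = f" if ef: "e \<in> S - {{v}}" "f \<in> S - {{v}}" for e f
      proof (rule ccontr)
        assume "e \<noteq> f"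
        moreover have "e \<in> E" "f \<in> E" "v \<in> e \<inter> f"
          using ef v(2) by (auto simp: cone_def)
        ultimately have "{e, f} \<in> P"
          unfolding P_iff by blast
        then show False
          using S(2)[of "{e, f}"] ef by blast
      qed
      have "card (S - {{v}}) \<le> 1"
        using eq by (metis One_nat_def card_le_Suc0_iff_eq card.infinite zero_le)
      then show ?thesis
        by (simp add: card_Diff_singleton_if split: if_splits)
    qed
    have face: "{v} \<in> B" if "v \<in> S" "S \<in> B" for v S
      using abstract_complex_subset[OF B that(2)] that(1) by blast
    show "{{u0}} \<in> B"
      using face[OF _ flag[OF u0]] by blast
    show "({u0}, X) \<in> ?R\<^sup>*" if X: "{X} \<in> B" for X
    proof -
      obtain v where v: "v \<in> \<Union>E" "X \<in> cone v"
        using ME[of "{X}"] X unfolding B_def by blast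
      have v_reach: "({u0}, {v}) \<in> ?R\<^sup>*"
        using reach conn[of u0 v] u0 v(1) by blast
      show ?thesis
      proof (cases "X = {v}")
        case True
        then show ?thesis
          using v_reach by simp
      next
        case False
        then have "({v}, X) \<in> ?R"
          using v(2) flag by (auto simp: cone_def)
        then show ?thesis
          using v_reach by (meson rtrancl.rtrancl_into_rtrancl)
      qed
    qed
  qed
  then show ?thesis
    using homotopy_eqv_trans[OF homotopy_eqv_trans[OF LM MB]] by blast
qed

lemma wheel_free_subgraph:
  assumes "wheel_free G" "verts G' \<subseteq> verts G" "edges G' \<subseteq> edges G"
  shows "wheel_free G'"
  using assms unfolding wheel_free_def subgraph_def by blast

text \<open>A connected graph without edges is a single vertex; the realization of its line complex
  is empty, whereas a wedge of zero circles is a point. Hence the hypothesis on the edges.\<close>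

theorem theorem4p1:
  fixes G :: "'a ugraph"
  assumes "simple_graph G" and "finite (verts G)"
    and "connected_graph G" and "wheel_free G"
    and "edges G \<noteq> {}"
  shows "\<exists>k. geometric_realization (clique_complex (line_graph G)) homotopy_eqv wedge_of_circles k"
proof -
  have "\<exists>k. geometric_realization (line_complex (edges G)) homotopy_eqv wedge_of_circles k"
    using assms
  proof (induction "card (edges G)" arbitrary: G rule: less_induct)
    case less
    note G = \<open>simple_graph G\<close> \<open>finite (verts G)\<close> \<open>wheel_free G\<close>
    have card2: "\<And>e. e \<in> edges G \<Longrightarrow> card e = 2" and EV: "\<Union>(edges G) \<subseteq> verts G"
      using simple_graph_card[OF G(1)] by blast+
    have "edges G \<subseteq> Pow (verts G)"
      using EV by blast
    then have finE: "finite (edges G)"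
      using G(2) finite_subset by blast
    show ?case
    proof (cases "\<exists>a y z. {a, y} \<in> edges G \<and> {a, z} \<in> edges G \<and> {y, z} \<in> edges G")
      case False
      show ?thesis
      proof (rule triangle_free_line_complex_homotopy_eqv_wedge[OF finE \<open>edges G \<noteq> {}\<close> card2 False])
        show "(u, v) \<in> {(x, y). {x, y} \<in> edges G}\<^sup>*" if "u \<in> \<Union>(edges G)" "v \<in> \<Union>(edges G)" for u v
          using \<open>connected_graph G\<close> EV that unfolding connected_graph_def by blast
      qed
    next
      case True
      then obtain a b c where abc: "{a, b} \<in> edges G" "{a, c} \<in> edges G" "{b, c} \<in> edges G"
        and unique: "\<And>x. {a, x} \<in> edges G \<Longrightarrow> {b, x} \<in> edges G \<Longrightarrow> x = c"
        using wheel_free_edge_in_one_triangle[OF G] by metis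
      define G' where "G' = (verts G, edges G - {{a, b}})"
      have G': "verts G' = verts G" "edges G' = edges G - {{a, b}}"
        by (simp_all add: G'_def)
      have ne: "a \<noteq> b" "a \<noteq> c" "b \<noteq> c"
        using abc card2 by fastforce+
      then have ab: "{a, c} \<in> edges G'" "{b, c} \<in> edges G'"
        using abc by (auto simp: G'(2) doubleton_eq_iff)
      let ?R = "\<lambda>G. {(x, y). {x, y} \<in> edges G}"
      \<comment> \<open>The detour through \<open>c\<close> replaces the removed edge, so
        connectedness survives; the same two edges keep the edge set nonempty for the
        induction.\<close>
      have "(a, c) \<in> ?R G'" "(c, b) \<in> ?R G'" "(b, c) \<in> ?R G'" "(c, a) \<in> ?R G'"
        using ab by (auto simp: insert_commute)
      then have "(a, b) \<in> (?R G')\<^sup>*" "(b, a) \<in> (?R G')\<^sup>*"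
        by (meson converse_rtrancl_into_rtrancl r_into_rtrancl)+
      then have "?R G \<subseteq> (?R G')\<^sup>*"
        unfolding G'(2) by (auto simp: doubleton_eq_iff)
      then have "connected_graph G'"
        using \<open>connected_graph G\<close> rtrancl_subset_rtrancl[of "?R G" "?R G'"]
        unfolding connected_graph_def G'(1) by blast
      moreover have "simple_graph G'"
        using G(1) by (auto simp: simple_graph_def G')
      moreover have "wheel_free G'"
        by (rule wheel_free_subgraph[OF G(3)]) (auto simp: G')
      moreover have "card (edges G') < card (edges G)"
        unfolding G'(2) using finE abc(1) by (rule card_Diff1_less)
      ultimately have "\<exists>k. geometric_realization (line_complex (edges G')) homotopy_eqv wedge_of_circles k"
        using less.hyps[of G'] G(2) ab by (auto simp: G'(1))
      moreover have "geometric_realization (line_complex (edges G)) homotopy_eqv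
          geometric_realization (line_complex (edges G'))"
        unfolding G'(2) by (rule line_complex_remove_edge[OF finE card2 abc unique])
      ultimately show ?thesis
        using homotopy_eqv_trans by blast
    qed
  qed
  then show ?thesis
    by (simp add: clique_complex_line_graph[OF \<open>simple_graph G\<close>])
qed

end
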